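(* Let $X$ be any dendro-minimal dendrite not reduced to a point, and let $G=\mathrm{Homeo}(X)$. (i) If $X$ has no free arc, then $G_{\mathrm{Br}}$ is a simple group. (ii) If $X$ admits some free arc but is not reduced to it (i.e. $X$ is not homeomorphic to $[0,1]$), then the image of $G_{\mathrm{Br}}$ in $\mathrm{Aut}(\mathrm{Free}(X))$ is a simple group.
   Context: A dendrite is a locally connected, connected, compact metrisable space containing no simple closed curve. A sub-dendrite of $X$ is a non-empty closed connected subset. $X$ is dendro-minimal if there is no proper sub-dendrite of $X$ invariant under the group $\mathrm{Homeo}(X)$ of all homeomorphisms of $X$. The order of a point $x\in X$ is the cardinality of the set of connected components of $X\setminus\{x\}$; branch points are the points of order at least three. $G_{\mathrm{Br}}\lhd G$ is the subgroup generated by all stabilisers in $G$ of branch points. A free arc of $X$ is an arc (homeomorphic copy of $[0,1]$, not reduced to a point) whose interior (the arc without its two extremities) is open in $X$. $\mathrm{Free}(X)$ is the countable set of all maximal free arcs of $X$; $\mathrm{Aut}(\mathrm{Free}(X))$ is the image of $\mathrm{Homeo}(X)$ in the permutation group of $\mathrm{Free}(X)$.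
   Formalization: Here "simple" means having no normal subgroups other than the trivial one and the whole group, so the trivial group is allowed; both groups can be trivial under the stated hypotheses. *)

theory Defs
  imports "HOL-Analysis.Analysis" "HOL-Algebra.Bij" "HOL-Algebra.Group_Action"
    "HOL-Algebra.Generated_Groups" "HOL-Algebra.SimpleGroups"
begin

definition dendrite :: "'a topology \<Rightarrow> bool" where
  "dendrite X \<longleftrightarrow>
     topspace X \<noteq> {} \<and> connected_space X \<and> locally_connected_space X \<and>
     compact_space X \<and> metrizable_space X \<and>
     \<not> (\<exists>S \<subseteq> topspace X.
          subtopology X S homeomorphic_space top_of_set (sphere (0::complex) 1))"

definition subdendrite :: "'a topology \<Rightarrow> 'a set \<Rightarrow> bool" where
  "subdendrite X Y \<longleftrightarrow> Y \<noteq> {} \<and> closedin X Y \<and> connectedin X Y"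

text \<open>As in \<^const>\<open>BijGroup\<close>, self-maps of the space are taken to be extensional, so that each
  homeomorphism is represented by exactly one function on the ambient type.\<close>

definition homeo_group :: "'a topology \<Rightarrow> ('a \<Rightarrow> 'a) monoid" where
  "homeo_group X =
     (BijGroup (topspace X))\<lparr>carrier := {g \<in> Bij (topspace X). homeomorphic_map X X g}\<rparr>"

definition dendro_minimal :: "'a topology \<Rightarrow> bool" where
  "dendro_minimal X \<longleftrightarrow>
     \<not> (\<exists>Y. subdendrite X Y \<and> Y \<noteq> topspace X \<and> (\<forall>g \<in> carrier (homeo_group X). g ` Y = Y))"

definition branch_points :: "'a topology \<Rightarrow> 'a set" where
  "branch_points X =
     {x \<in> topspace X.
        let C = connected_components_of (subtopology X (topspace X - {x}))
        in infinite C \<or> card C \<ge> 3}"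

definition G_Br :: "'a topology \<Rightarrow> ('a \<Rightarrow> 'a) monoid" where
  "G_Br X =
     (homeo_group X)\<lparr>carrier :=
        generate (homeo_group X) (\<Union>x \<in> branch_points X. stabilizer (homeo_group X) (\<lambda>g. g) x)\<rparr>"

definition free_arc :: "'a topology \<Rightarrow> 'a set \<Rightarrow> bool" where
  "free_arc X A \<longleftrightarrow>
     (\<exists>h. embedding_map (top_of_set {0..1::real}) X h \<and> A = h ` {0..1} \<and> openin X (A - {h 0, h 1}))"

definition Free :: "'a topology \<Rightarrow> 'a set set" where
  "Free X = {A. free_arc X A \<and> (\<forall>B. free_arc X B \<longrightarrow> A \<subseteq> B \<longrightarrow> B = A)}"

definition free_perm :: "'a topology \<Rightarrow> ('a \<Rightarrow> 'a) \<Rightarrow> ('a set \<Rightarrow> 'a set)" where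
  "free_perm X g = (\<lambda>A \<in> Free X. g ` A)"

definition Aut_Free :: "'a topology \<Rightarrow> ('a set \<Rightarrow> 'a set) monoid" where
  "Aut_Free X = (BijGroup (Free X))\<lparr>carrier := free_perm X ` carrier (homeo_group X)\<rparr>"

definition G_Br_image :: "'a topology \<Rightarrow> ('a set \<Rightarrow> 'a set) monoid" where
  "G_Br_image X = (Aut_Free X)\<lparr>carrier := free_perm X ` carrier (G_Br X)\<rparr>"

text \<open>The library locale \<^locale>\<open>simple_group\<close> demands \<^prop>\<open>order G > 1\<close>, and \<^const>\<open>order\<close> is
  \<^const>\<open>card\<close> of the carrier, hence \<open>0\<close> for infinite groups: it only covers finite simple groups.
  Simplicity is read here as the absence of normal subgroups other than the trivial one and
  the whole group. The trivial group is not excluded: both groups considered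
  can be trivial. For example, let \<open>X\<close> be the end compactification of the universal cover of a
  finite graph of minimal degree at least three whose coarsest equitable partition is discrete.
  It is dendro-minimal, has free arcs, and every homeomorphism fixing a branch point fixes every
  maximal free arc.\<close>

definition is_simple :: "('a, 'b) monoid_scheme \<Rightarrow> bool" where
  "is_simple G \<longleftrightarrow> group G \<and> (\<forall>N. N \<lhd> G \<longrightarrow> N = {\<one>\<^bsub>G\<^esub>} \<or> N = carrier G)"

end

theory Submission
  imports Defs "HOL-Probability.Discrete_Topology"
begin

text \<open>Since no circle embeds in \<open>X\<close>, any two points are joined
  by exactly one arc, so that intersections of
  connected sets are connected and every component at a point has that point as its whole boundary.

  A stabiliser of a branch point is generated
    by homeomorphisms \<open>h\<close> that fix a component \<open>C\<close> at a branch
  point \<open>p\<close> pointwise: compose with a swap of two components, which leaves a third one alone. Let \<open>N\<close> be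
  normal in \<open>G_Br\<close> and contain an element moving a branch point. Dendro-minimality passes from the full
  group to \<open>G_Br\<close> and then to \<open>N\<close>, hence,
    by a Helly argument, every proper subdendrite is disjoint from
  one of its translates under \<open>N\<close>. Applied to the complements of three components \<open>C\<close>, \<open>D\<close>, \<open>E\<close> at \<open>p\<close>,
  this gives an element of \<open>N\<close> mapping the complement of \<open>C\<close>, which supports \<open>h\<close>, into \<open>C\<close>, and an \<open>s\<close> in
  \<open>N\<close> mapping the complement of \<open>D\<close> into \<open>E\<close>. The translates of \<open>C\<close> under \<open>s\<close> are then pairwise
  disjoint, and a homeomorphism supported in \<open>C\<close> is the commutator of \<open>s\<close> with an infinite product of
  its conjugates; this puts \<open>h\<close> into \<open>N\<close>.

  A homeomorphism fixing all branch points is trivial if there is no free arc, and preserves every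
  maximal free arc in general, because there are no branch points between a point and its image.\<close>

text \<open>The space is an abstract topology, while limits of paths need a complete normed space.
  \<open>X\<close> is therefore embedded once, to obtain arcs; afterwards everything is phrased by
  connected sets: \<open>interval a b\<close> is the hull of two points, and connectedness is
  convexity for it.

  The obstacle in the commutator step is that the infinite product \<open>F\<close> is a priori just
  some homeomorphism of \<open>X\<close>, whereas \<open>N\<close> is only normalised by
  \<open>G_Br\<close>. This is why the support is first moved into a component \<open>C\<close> at
  the branch point \<open>p\<close> and why the translates of \<open>C\<close> go into another
  component \<open>E\<close>: none of them contains \<open>p\<close>, so \<open>F\<close> fixes
  \<open>p\<close> and lies in \<open>G_Br\<close>. Continuity of \<open>F\<close> holds because the
  members of a disjoint family of connected sets become small near every limit point.

  One theorem serves (i) and (ii): a subgroup of \<open>G_Br\<close> that is normalised by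
  \<open>G_Br\<close> and moves a branch point is all of \<open>G_Br\<close>. For (ii) it is applied
  to the preimage in \<open>G_Br\<close> of a normal subgroup of the image.\<close>

subsection \<open>Paths in locally connected compact sets\<close>

text \<open>The vertices lie in \<open>S\<close>, but the segments joining them only lie in the ambient normed space; a path in
  \<open>S\<close> arises as the uniform limit of successive refinements.\<close>

inductive polygonal :: "'b::real_normed_vector set \<Rightarrow> real \<Rightarrow> (real \<Rightarrow> 'b) \<Rightarrow> bool" for S d where
  line: "\<lbrakk>x \<in> S; y \<in> S; dist x y < d\<rbrakk> \<Longrightarrow> polygonal S d (linepath x y)"
| join: "\<lbrakk>polygonal S d f; polygonal S d g; pathfinish f = pathstart g\<rbrakk>
  \<Longrightarrow> polygonal S d (f +++ g)"

lemma polygonal_path: "polygonal S d f \<Longrightarrow> path f"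
  by (induction rule: polygonal.induct) auto

lemma polygonal_reversepath: "polygonal S d f \<Longrightarrow> polygonal S d (reversepath f)"
  by (induction rule: polygonal.induct)
     (auto simp: reversepath_joinpaths dist_commute intro: polygonal.intros)

lemma polygonal_near:
  assumes "polygonal S d f" "t \<in> {0..1}"
  shows "\<exists>z\<in>S. dist (f t) z < d"
  using assms
proof (induction arbitrary: t rule: polygonal.induct)
  case (line x y)
  have "linepath x y t \<in> closed_segment x y"
    using line.prems by (metis linepath_image_01 imageI)
  then have "dist (linepath x y t) x \<le> dist x y"
    using segment_bound1 by (fastforce simp: dist_norm norm_minus_commute)
  then show ?case
    using line by (intro bexI[of _ x]) auto
next
  case (join f g)
  then show ?case
    by (cases "t \<le> 1/2") (auto simp: joinpaths_def)
qed

text \<open>Being joined by such a chain is an equivalence relation on \<open>K\<close> with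
  relatively open classes, hence total because \<open>K\<close> is connected. Balls are convex,
  which keeps the segments inside \<open>ball c r\<close>.\<close>

lemma polygonal_within_ball:
  fixes S :: "'b::real_normed_vector set"
  assumes "connected K" "K \<subseteq> S" "K \<subseteq> ball c r" "0 < d" "u \<in> K" "v \<in> K"
  obtains f where "polygonal S d f" "pathstart f = u" "pathfinish f = v" "path_image f \<subseteq> ball c r"
proof -
  define R where "R u v \<longleftrightarrow>
      (\<exists>f. polygonal S d f \<and> pathstart f = u \<and> pathfinish f = v \<and>
        path_image f \<subseteq> ball c r)" for u v
  have "R u v"
  proof (rule connected_equivalence_relation[OF assms(1,5,6)])
    show "R y x" if "R x y" for x y
      using that unfolding R_def
      by (metis polygonal_reversepath pathstart_reversepath pathfinish_reversepath path_image_reversepath)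
    show "R x z" if xyz: "R x y" "R y z" for x y z
    proof -
      obtain f g where "polygonal S d f" "pathstart f = x" "pathfinish f = y" "path_image f \<subseteq> ball c r"
        "polygonal S d g" "pathstart g = y" "pathfinish g = z" "path_image g \<subseteq> ball c r"
        using xyz unfolding R_def by blast
      then show ?thesis unfolding R_def
        by (intro exI[of _ "f +++ g"]) (auto intro: polygonal.join simp: path_image_join)
    qed
    show "\<exists>T. openin (top_of_set K) T \<and> x \<in> T \<and> (\<forall>y\<in>T. R x y)" if "x \<in> K" for x
    proof (intro exI[of _ "K \<inter> ball x d"] conjI ballI)
      fix y assume y: "y \<in> K \<inter> ball x d"
      have "closed_segment x y \<subseteq> ball c r"
        using that y assms(3) by (intro closed_segment_subset) auto
      then show "R x y" unfolding R_def
        using that y assms(2) by (intro exI[of _ "linepath x y"]) (auto intro!: polygonal.line)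
    qed (use that \<open>0 < d\<close> in auto)
  qed
  then show thesis using that unfolding R_def by blast
qed

text \<open>\<open>d\<close> is a Lebesgue number for the cover of \<open>S\<close> by open sets
  whose trace on \<open>S\<close> is connected and fits into a ball of radius \<open>e/2\<close>; a
  trace containing \<open>x\<close> then fits into \<open>ball x e\<close>.\<close>

lemma compact_locally_connected_uniform:
  fixes S :: "'b::metric_space set"
  assumes "compact S" "locally_connected_space (top_of_set S)" "0 < e"
  obtains d where "0 < d"
    "\<And>x y. \<lbrakk>x \<in> S; y \<in> S; dist x y < d\<rbrakk> \<Longrightarrow> \<exists>K. connected K \<and>
      K \<subseteq> S \<and> x \<in> K \<and> y \<in> K \<and> K \<subseteq> ball x e"
proof -
  define \<G> where "\<G> = {T. open T \<and> connected (S \<inter> T) \<and>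
    (\<exists>z. S \<inter> T \<subseteq> ball z (e/2))}"
  have "\<exists>T\<in>\<G>. z \<in> T" if "z \<in> S" for z
  proof -
    have "openin (top_of_set S) (S \<inter> ball z (e/2))" "z \<in> S \<inter> ball z (e/2)"
      using that assms by auto
    then obtain U where U: "openin (top_of_set S) U" "connectedin (top_of_set S) U" "z \<in> U"
      "U \<subseteq> S \<inter> ball z (e/2)"
      using assms(2) unfolding locally_connected_space by metis
    obtain T where T: "open T" "U = S \<inter> T"
      using U(1) by (meson openin_open)
    have "connected (S \<inter> T)" using U(2) T(2) by (simp add: connectedin_subtopology)
    moreover have "z \<in> T" "S \<inter> T \<subseteq> ball z (e/2)" using U(3,4) T(2) by auto
    ultimately show ?thesis unfolding \<G>_def using T(1) by blast
  qed
  then have "S \<subseteq> \<Union>\<G>" by blast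
  then obtain d where d: "0 < d" "\<And>x. x \<in> S \<Longrightarrow> \<exists>G\<in>\<G>. ball x d \<subseteq> G"
    using Heine_Borel_lemma[OF assms(1), of \<G>] \<G>_def by (metis (mono_tags, lifting) mem_Collect_eq)
  show thesis
  proof (rule that[OF d(1)])
    fix x y assume xy: "x \<in> S" "y \<in> S" "dist x y < d"
    obtain T z where T: "ball x d \<subseteq> T" "connected (S \<inter> T)" "S \<inter> T \<subseteq> ball z (e/2)"
      using d(2)[OF xy(1)] unfolding \<G>_def by blast
    have "S \<inter> T \<subseteq> ball x e"
    proof
      fix w assume "w \<in> S \<inter> T"
      moreover have "x \<in> S \<inter> T" using xy T(1) d(1) by auto
      ultimately have "dist z w < e/2" "dist z x < e/2" using T(3) by auto
      then show "w \<in> ball x e"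
        using dist_triangle[of x w z] by (simp add: dist_commute)
    qed
    then show "\<exists>K. connected K \<and> K \<subseteq> S \<and> x \<in> K \<and> y \<in> K \<and>
      K \<subseteq> ball x e"
      using T xy d(1) by (intro exI[of _ "S \<inter> T"]) auto
  qed
qed

text \<open>Each segment is replaced by a finer chain along a small connected subset of
  \<open>S\<close> containing its ends. Segment and replacement stay in one ball of radius
  \<open>e\<close>, hence the factor 2.\<close>

lemma polygonal_refine:
  fixes S :: "'b::real_normed_vector set"
  assumes d: "\<And>x y. \<lbrakk>x \<in> S; y \<in> S; dist x y < d\<rbrakk> \<Longrightarrow>
      \<exists>K. connected K \<and> K \<subseteq> S \<and> x \<in> K \<and> y \<in> K \<and> K \<subseteq> ball x e"
    and "polygonal S d f" "0 < d'"
  shows "\<exists>g. polygonal S d' g \<and> pathstart g = pathstart f \<and> pathfinish g = pathfinish f \<and>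
           (\<forall>t\<in>{0..1}. dist (f t) (g t) < 2 * e)"
  using assms(2)
proof (induction rule: polygonal.induct)
  case (line x y)
  obtain K where K: "connected K" "K \<subseteq> S" "x \<in> K" "y \<in> K" "K \<subseteq> ball x e"
    using d line by blast
  obtain g where g: "polygonal S d' g" "pathstart g = x" "pathfinish g = y" "path_image g \<subseteq> ball x e"
    using polygonal_within_ball[OF K(1,2,5) assms(3) K(3,4)] by blast
  have "dist (linepath x y t) (g t) < 2 * e" if "t \<in> {0..1}" for t
  proof -
    have "closed_segment x y \<subseteq> ball x e"
      using K by (intro closed_segment_subset) auto
    then have "linepath x y t \<in> ball x e"
      using that linepath_image_01[of x y] by blast
    moreover have "g t \<in> ball x e"
      using g(4) that unfolding path_image_def by blast
    ultimately show ?thesis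
      using dist_triangle2[of "linepath x y t" "g t" x] by (auto simp: dist_commute)
  qed
  then show ?case using g by auto
next
  case (join f1 f2)
  then obtain g1 g2 where g: "polygonal S d' g1" "pathstart g1 = pathstart f1" "pathfinish g1 = pathfinish f1"
     "\<forall>t\<in>{0..1}. dist (f1 t) (g1 t) < 2 * e"
     "polygonal S d' g2" "pathstart g2 = pathstart f2" "pathfinish g2 = pathfinish f2"
     "\<forall>t\<in>{0..1}. dist (f2 t) (g2 t) < 2 * e" by blast
  have "dist ((f1 +++ f2) t) ((g1 +++ g2) t) < 2 * e" if "t \<in> {0..1}" for t
    using g that by (auto simp: joinpaths_def)
  then show ?case using g join by (intro exI[of _ "g1 +++ g2"]) (auto intro: polygonal.join)
qed

lemma compact_locally_connected_uniform_path:
  fixes S :: "'b::{complete_space,real_normed_vector} set"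
  assumes S: "compact S" "locally_connected_space (top_of_set S)" and e: "0 < e"
  obtains d where "0 < d"
    "\<And>x y. \<lbrakk>x \<in> S; y \<in> S; dist x y < d\<rbrakk> \<Longrightarrow>
       \<exists>g. path g \<and> path_image g \<subseteq> S \<inter> ball x e \<and> pathstart g = x \<and> pathfinish g = y"
proof -
  \<comment> \<open>Stage \<open>n\<close> moves the path by less than
    \<open>2 * \<epsilon> n\<close>, all stages together by at most
    \<open>4 * \<epsilon> 0 = e/2\<close>. The initial segment is shorter than
    \<open>\<epsilon> 0 = e/8\<close>, so the limit stays within \<open>5 * \<epsilon> 0 < e\<close>
    of \<open>x\<close>.\<close>
  define \<epsilon> where "\<epsilon> n = e / (8 * 2^n)" for n :: nat
  have eps: "\<epsilon> n > 0" "\<epsilon> (Suc n) = \<epsilon> n / 2" for n using e by (auto simp: \<epsilon>_def)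
  have "\<exists>d>0. d \<le> \<epsilon> n \<and> (\<forall>x\<in>S. \<forall>y\<in>S. dist x y < d \<longrightarrow>
      (\<exists>K. connected K \<and> K \<subseteq> S \<and> x \<in> K \<and> y \<in> K \<and>
        K \<subseteq> ball x (\<epsilon> n)))" for n
  proof -
    obtain d where "0 < d" "\<And>x y. \<lbrakk>x \<in> S; y \<in> S; dist x y < d\<rbrakk> \<Longrightarrow>
       \<exists>K. connected K \<and> K \<subseteq> S \<and> x \<in> K \<and> y \<in> K \<and>
         K \<subseteq> ball x (\<epsilon> n)"
      using compact_locally_connected_uniform[OF S eps(1)] by blast
    then show ?thesis
      using eps(1)[of n] by (intro exI[of _ "min d (\<epsilon> n)"]) auto
  qed
  then obtain \<delta> where \<delta>: "\<And>n. \<delta> n > 0" "\<And>n. \<delta> n \<le> \<epsilon> n"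
    "\<And>n x y. \<lbrakk>x \<in> S; y \<in> S; dist x y < \<delta> n\<rbrakk> \<Longrightarrow>
       \<exists>K. connected K \<and> K \<subseteq> S \<and> x \<in> K \<and> y \<in> K \<and>
         K \<subseteq> ball x (\<epsilon> n)"
    by metis
  show thesis
  proof (rule that[OF \<delta>(1)[of 0]])
    fix x y assume xy: "x \<in> S" "y \<in> S" "dist x y < \<delta> 0"
    have "\<exists>f. f 0 = linepath x y \<and> (\<forall>n. (polygonal S (\<delta> n) (f n) \<and>
      pathstart (f n) = x \<and> pathfinish (f n) = y) \<and>
        (\<forall>t\<in>{0..1}. dist (f n t) (f (Suc n) t) < 2 * \<epsilon> n))"
    proof -
      have "\<exists>f. \<forall>n. ((polygonal S (\<delta> n) (f n) \<and> pathstart (f n) = x \<and>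
        pathfinish (f n) = y) \<and> (n = 0 \<longrightarrow> f n = linepath x y)) \<and>
        (\<forall>t\<in>{0..1}. dist (f n t) (f (Suc n) t) < 2 * \<epsilon> n)"
      proof (rule dependent_nat_choice)
        show "\<exists>f. (polygonal S (\<delta> 0) f \<and> pathstart f = x \<and> pathfinish f = y) \<and>
          ((0::nat) = 0 \<longrightarrow> f = linepath x y)"
          using xy by (auto intro: polygonal.line)
      next
        fix f n
        assume *: "(polygonal S (\<delta> n) f \<and> pathstart f = x \<and> pathfinish f = y) \<and>
          (n = 0 \<longrightarrow> f = linepath x y)"
        then obtain g where "polygonal S (\<delta> (Suc n)) g" "pathstart g = x" "pathfinish g = y"
           "\<forall>t\<in>{0..1}. dist (f t) (g t) < 2 * \<epsilon> n"
          using polygonal_refine[of S "\<delta> n"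
            "\<epsilon> n" f "\<delta> (Suc n)"] \<delta>(3)[of _ _ n] \<delta>(1)[of "Suc n"] by (elim conjE) metis
        then show "\<exists>g. ((polygonal S (\<delta> (Suc n)) g \<and> pathstart g = x \<and>
          pathfinish g = y) \<and> (Suc n = 0 \<longrightarrow> g = linepath x y)) \<and>
            (\<forall>t\<in>{0..1}. dist (f t) (g t) < 2 * \<epsilon> n)"
          by auto
      qed
      then show ?thesis by blast
    qed
    then obtain f where f0: "f 0 = linepath x y" and f: "\<And>n. polygonal S (\<delta> n) (f n)"
       "\<And>n. pathstart (f n) = x" "\<And>n. pathfinish (f n) = y"
       "\<And>n t. t \<in> {0..1} \<Longrightarrow> dist (f n t) (f (Suc n) t) < 2 * \<epsilon> n"
      by blast
    \<comment> \<open>As \<open>\<epsilon>\<close> halves at each stage,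
      \<open>2 * \<epsilon> m = 4 * \<epsilon> m - 4 * \<epsilon> (Suc m)\<close>; the subtracted
      term makes the induction telescope.\<close>
    have close: "dist (f n t) (f (n + k) t) \<le> 4 * \<epsilon> n - 4 * \<epsilon> (n + k)" if t: "t \<in> {0..1}" for n k t
    proof (induction k)
      case (Suc k)
      have "dist (f n t) (f (n + Suc k) t) \<le> dist (f n t) (f (n + k) t) + dist (f (n + k) t) (f (Suc (n + k)) t)"
        using dist_triangle by auto
      also have "\<dots> \<le> 4 * \<epsilon> n - 4 * \<epsilon> (n + k) + 2 * \<epsilon> (n + k)"
        using Suc f(4)[OF t, of "n + k"] by linarith
      also have "\<dots> = 4 * \<epsilon> n - 4 * \<epsilon> (n + Suc k)"
        using eps(2)[of "n + k"] by simp
      finally show ?case .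
    qed simp
    have close': "dist (f n t) (f m t) \<le> 4 * \<epsilon> n" if "t \<in> {0..1}" "n \<le> m" for n m t
      using close[OF that(1), of n "m - n"] that(2) eps(1)[of m] by auto
    have eps0: "\<epsilon> \<longlonglongrightarrow> 0"
      unfolding \<epsilon>_def using LIMSEQ_divide_realpow_zero[of 2 "e/8"] by (simp add: field_simps)
    have small: "\<exists>M. \<forall>n\<ge>M. 4 * \<epsilon> n < r" if "r > 0" for r :: real
    proof -
      have "\<forall>\<^sub>F n in sequentially. \<epsilon> n < r / 4"
        using that by (intro order_tendstoD(2)[OF eps0]) auto
      then show ?thesis unfolding eventually_sequentially by (auto simp: field_simps)
    qed
    have "uniformly_Cauchy_on {0..1} f"
    proof (rule uniformly_Cauchy_onI')
      fix r :: real assume "r > 0"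
      then obtain M where "\<forall>n\<ge>M. 4 * \<epsilon> n < r" using small by blast
      then show "\<exists>M. \<forall>t\<in>{0..1}. \<forall>m\<ge>M. \<forall>n>m. dist (f m t) (f n t) < r"
        using close' by (intro exI[of _ M] ballI allI impI) (meson le_less_trans less_imp_le)
    qed
    then obtain l where l: "uniform_limit {0..1} f l sequentially"
      using Cauchy_uniformly_convergent unfolding uniformly_convergent_on_def by blast
    have cont: "continuous_on {0..1} l"
    proof (rule uniform_limit_theorem[OF _ l])
      show "\<forall>\<^sub>F n in sequentially. continuous_on {0..1} (f n)"
        using f(1) polygonal_path unfolding path_def by (intro always_eventually) auto
    qed simp
    have lim: "(\<lambda>n. f n t) \<longlonglongrightarrow> l t" if "t \<in> {0..1}" for t
      using tendsto_uniform_limitI[OF l that] .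
    \<comment> \<open>\<open>f n t\<close> is within \<open>\<delta> n\<close>, hence within
      \<open>\<epsilon> n\<close>, of a point \<open>z n\<close> of \<open>S\<close>. So the points
      \<open>z n\<close> have the same limit, and \<open>S\<close> is closed.\<close>
    have inS: "l t \<in> S" if t: "t \<in> {0..1}" for t
    proof -
      have "\<exists>z. \<forall>n. z n \<in> S \<and> dist (f n t) (z n) < \<delta> n"
        using polygonal_near[OF f(1) t] by (intro choice) blast
      then obtain z where z: "\<And>n. z n \<in> S" "\<And>n. dist (f n t) (z n) < \<delta> n" by blast
      have "(\<lambda>n. dist (f n t) (z n)) \<longlonglongrightarrow> 0"
        by (rule tendsto_sandwich[OF _ _ tendsto_const eps0])
           (use z(2) \<delta>(2) in \<open>auto intro!: always_eventually less_imp_le intro: order_less_le_trans\<close>)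
      then have "z \<longlonglongrightarrow> l t"
        using Lim_transform2[OF lim[OF t]] by (auto simp: dist_norm tendsto_norm_zero_iff)
      then show ?thesis
        using closed_sequentially[OF compact_imp_closed[OF S(1)]] z(1) by blast
    qed
    have near: "l t \<in> ball x e" if t: "t \<in> {0..1}" for t
    proof -
      have "dist (f 0 t) (l t) \<le> 4 * \<epsilon> 0"
      proof (rule tendsto_upperbound)
        show "(\<lambda>n. dist (f 0 t) (f n t)) \<longlonglongrightarrow> dist (f 0 t) (l t)"
          by (intro tendsto_intros lim t)
      qed (use close'[OF t] in auto)
      moreover have "dist x (f 0 t) \<le> dist x y"
      proof -
        have "f 0 t \<in> closed_segment x y"
          unfolding f0 using t linepath_image_01[of x y] by blast
        then show ?thesis using segment_bound1 by (fastforce simp: dist_norm norm_minus_commute)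
      qed
      moreover have "dist x y < \<epsilon> 0" using xy(3) \<delta>(2)[of 0] by simp
      moreover have "5 * \<epsilon> 0 < e" using e by (simp add: \<epsilon>_def)
      ultimately show ?thesis
        using dist_triangle[of x "l t" "f 0 t"] by auto
    qed
    have "l 0 = x"
      using LIMSEQ_unique[OF lim[of 0]] f(2) by (simp add: pathstart_def)
    moreover have "l 1 = y"
      using LIMSEQ_unique[OF lim[of 1]] f(3) by (simp add: pathfinish_def)
    ultimately show "\<exists>g. path g \<and> path_image g \<subseteq> S \<inter> ball x e \<and>
      pathstart g = x \<and> pathfinish g = y"
      using cont inS near
      by (intro exI[of _ l]) (auto simp: path_def path_image_def pathstart_def pathfinish_def)
  qed
qed

text \<open>Being joined by a path inside \<open>U\<close> is an equivalence relation whose classes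
  are open by the uniform local paths, so connectedness of \<open>U\<close> leaves a single class. A
  path between distinct points contains an arc.\<close>

lemma connected_open_imp_arc:
  fixes S :: "'b::{complete_space,real_normed_vector} set"
  assumes S: "compact S" "locally_connected_space (top_of_set S)"
    and U: "openin (top_of_set S) U" "connected U" and ab: "a \<in> U" "b \<in> U" "a \<noteq> b"
  obtains g where "arc g" "path_image g \<subseteq> U" "pathstart g = a" "pathfinish g = b"
proof -
  define R where "R x y \<longleftrightarrow> (\<exists>g. path g \<and> path_image g \<subseteq> U \<and>
    pathstart g = x \<and> pathfinish g = y)" for x y
  have "R a b"
  proof (rule connected_equivalence_relation[OF U(2) ab(1,2)])
    show "R y x" if "R x y" for x y
      using that unfolding R_def
      by (metis path_reversepath pathstart_reversepath pathfinish_reversepath path_image_reversepath)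
    show "R x z" if "R x y" "R y z" for x y z
      using that unfolding R_def by (metis path_join_imp pathstart_join pathfinish_join subset_path_image_join)
    show "\<exists>T. openin (top_of_set U) T \<and> x \<in> T \<and> (\<forall>y\<in>T. R x y)" if x: "x \<in> U" for x
    proof -
      obtain e where e: "e > 0" "S \<inter> ball x e \<subseteq> U"
        using U(1) x by (auto simp: openin_contains_ball Int_commute)
      obtain d where d: "0 < d" "\<And>x y. \<lbrakk>x \<in> S; y \<in> S; dist x y < d\<rbrakk> \<Longrightarrow>
       \<exists>g. path g \<and> path_image g \<subseteq> S \<inter> ball x e \<and> pathstart g = x \<and> pathfinish g = y"
        using compact_locally_connected_uniform_path[OF S e(1)] by blast
      have US: "U \<subseteq> S" using U(1) openin_imp_subset by blast
      have "R x y" if "y \<in> U \<inter> ball x d" for y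
        using d(2)[of x y] x that US e(2) unfolding R_def by fastforce
      then show ?thesis
        using x d(1) by (intro exI[of _ "U \<inter> ball x d"]) auto
    qed
  qed
  then obtain p where p: "path p" "path_image p \<subseteq> U" "pathstart p = a" "pathfinish p = b"
    unfolding R_def by blast
  obtain q where "arc q" "path_image q \<subseteq> path_image p" "pathstart q = a" "pathfinish q = b"
    using path_contains_arc[OF p(1,3,4) ab(3)] by blast
  then show thesis using that p(2) by blast
qed

subsection \<open>Arcs in dendrites\<close>

text \<open>Around \<open>t\<close> the arc \<open>h\<close> avoids \<open>k\<close> on a maximal
  parameter interval. This piece of \<open>h\<close> meets \<open>k\<close> only at its two ends,
  and closing it up along \<open>k\<close> gives a circle.\<close>

lemma two_arcs_contain_circle:
  fixes h k :: "real \<Rightarrow> 'b::real_normed_vector"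
  assumes "arc h" "arc k" "pathstart h = pathstart k" "pathfinish h = pathfinish k"
    and t: "t \<in> {0..1}" "h t \<notin> path_image k"
  obtains T where "T \<subseteq> path_image h \<union> path_image k" "T homeomorphic sphere (0::complex) 1"
proof -
  define C where "C = {0..1} \<inter> h -` path_image k"
  have "compact C" unfolding C_def
    using assms(1,2)
    by (intro closedin_compact[OF compact_Icc[of 0 1]] continuous_closedin_preimage)
       (auto simp: arc_def path_def closed_path_image)
  have C01: "0 \<in> C" "1 \<in> C"
    using assms(3,4) pathstart_in_path_image[of k] pathfinish_in_path_image[of k]
    by (auto simp: C_def pathstart_def pathfinish_def)
  have "t \<notin> C" using t(2) by (simp add: C_def)
  \<comment> \<open>\<open>t1\<close> is the last visit to \<open>k\<close> before time
    \<open>t\<close>, \<open>t2\<close> the first one after it; they exist because \<open>C\<close>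
    is compact and contains 0 and 1.\<close>
  obtain t1 where t1: "t1 \<in> C" "t1 \<le> t" "\<And>u. u \<in> C \<Longrightarrow> u \<le> t \<Longrightarrow> u \<le> t1"
    using compact_attains_sup[of "C \<inter> {..t}"] \<open>compact C\<close> C01 t(1) by (force intro: compact_Int_closed)
  obtain t2 where t2: "t2 \<in> C" "t \<le> t2" "\<And>u. u \<in> C \<Longrightarrow> t \<le> u \<Longrightarrow> t2 \<le> u"
    using compact_attains_inf[of "C \<inter> {t..}"] \<open>compact C\<close> C01 t(1) by (force intro: compact_Int_closed)
  have lt: "t1 < t" "t < t2" using t1(1,2) t2(1,2) \<open>t \<notin> C\<close> by (metis order_le_less)+
  have in01: "t1 \<in> {0..1}" "t2 \<in> {0..1}" using t1(1) t2(1) by (auto simp: C_def)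
  obtain s1 s2 where s: "s1 \<in> {0..1}" "s2 \<in> {0..1}" "h t1 = k s1" "h t2 = k s2"
    using t1(1) t2(1) by (auto simp: C_def path_image_def)
  have "h t1 \<noteq> h t2"
    using assms(1) in01 lt unfolding arc_def inj_on_def by fastforce
  then have "s2 \<noteq> s1" using s by auto
  let ?g = "subpath t1 t2 h +++ subpath s2 s1 k"
  have "path_image (subpath t1 t2 h) \<inter> path_image k \<subseteq> {h t1, h t2}"
  proof
    fix x assume x: "x \<in> path_image (subpath t1 t2 h) \<inter> path_image k"
    then obtain u where u: "t1 \<le> u" "u \<le> t2" "x = h u"
      using lt by (auto simp: path_image_subpath)
    then have "u \<in> C" using x in01 by (auto simp: C_def)
    then have "u = t1 \<or> u = t2" using t1(3) t2(3) u by force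
    then show "x \<in> {h t1, h t2}" using u(3) by auto
  qed
  then have "path_image (subpath t1 t2 h) \<inter> path_image (subpath s2 s1 k) \<subseteq> {h t1, h t2}"
    using path_image_subpath_subset[of s2 s1 k] s(1,2) by auto
  then have "simple_path ?g"
    using assms(1,2) in01 lt s \<open>s2 \<noteq> s1\<close>
    by (intro simple_path_join_loop arc_subpath_arc) auto
  moreover have "pathfinish ?g = pathstart ?g" using s by simp
  ultimately have "path_image ?g homeomorphic sphere (0::complex) 1"
    by (intro homeomorphic_simple_path_image_circle) auto
  moreover have "path_image ?g \<subseteq> path_image h \<union> path_image k"
    using path_image_subpath_subset[of s2 s1 k] path_image_subpath_subset[of t1 t2 h] s(1,2) in01
    by (intro order_trans[OF path_image_join_subset]) auto
  ultimately show thesis using that by blast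
qed

text \<open>This is the Kuratowski embedding by the distance functions. The discrete copy of the type makes the
  space of bounded functions an instance of \<^class>\<open>complete_space\<close>.\<close>

lemma compact_metrizable_embedding:
  fixes X :: "'a topology"
  assumes "compact_space X" "metrizable_space X"
  obtains f :: "'a \<Rightarrow> 'a discrete \<Rightarrow>\<^sub>C real" where "embedding_map X euclidean f"
proof -
  obtain M d where M: "Metric_space M d" "X = Metric_space.mtopology M d"
    using assms(2) unfolding metrizable_space_def by blast
  interpret Metric_space M d by fact
  have top: "topspace X = M" using M(2) by simp
  have "compactin mtopology M"
    using assms(1) unfolding compact_space_def M(2) by simp
  then have "mbounded M" by (rule compactin_imp_mbounded)
  then have "\<exists>B. \<forall>x\<in>M. \<forall>y\<in>M. d x y \<le> B" by (simp only: mbounded_alt)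
  then obtain B where B: "\<And>x y. x \<in> M \<Longrightarrow> y \<in> M \<Longrightarrow> d x y \<le> B" by metis
  define \<phi> where "\<phi> x y = (if of_discrete y \<in> M then d x (of_discrete y) else 0)" for x y
  define f where "f x = Bcontfun (\<phi> x)" for x
  have f: "apply_bcontfun (f x) y = \<phi> x y" if "x \<in> M" for x y
  proof -
    have "norm (\<phi> x y) \<le> max 0 B" for y
      using B[OF that, of "of_discrete y"] by (auto simp: \<phi>_def)
    then have "bounded (range (\<phi> x))" unfolding bounded_iff by blast
    then have "\<phi> x \<in> bcontfun"
      unfolding bcontfun_def by (auto simp: continuous_on_open_vimage open_discrete)
    then show ?thesis by (simp add: f_def Bcontfun_inverse)
  qed
  have lip: "dist (f x) (f y) \<le> d x y" if "x \<in> M" "y \<in> M" for x y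
  proof (rule dist_bound)
    fix z
    show "dist (apply_bcontfun (f x) z) (apply_bcontfun (f y) z) \<le> d x y"
      using that triangle[of x y "of_discrete z"] triangle[of y x "of_discrete z"]
      by (auto simp: f \<phi>_def dist_real_def commute abs_le_iff)
  qed
  have "inj_on f M"
  proof (rule inj_onI)
    fix x y assume xy: "x \<in> M" "y \<in> M" "f x = f y"
    then have "\<phi> x (discrete y) = \<phi> y (discrete y)" using f by metis
    then show "x = y" using xy by (simp add: \<phi>_def discrete_inverse)
  qed
  moreover have "continuous_map X euclidean f"
  proof -
    have "continuous_map mtopology (Metric_space.mtopology UNIV dist) f"
      unfolding metric_continuous_map[OF Met_TC.Metric_space_axioms]
      using lip by (auto intro: le_less_trans)
    then show ?thesis using M(2) by (simp add: mtopology_is_euclidean)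
  qed
  ultimately have "embedding_map X euclidean f"
    using assms(1) top by (intro continuous_imp_embedding_map) auto
  then show thesis using that by blast
qed

text \<open>The absence of circles enters here: a connected set through \<open>a\<close> and
  \<open>b\<close> that misses a point of the arc yields a second arc avoiding this point, and both
  arcs together contain a circle.\<close>

lemma dendrite_arc:
  fixes X :: "'a topology"
  assumes X: "dendrite X" and ab: "a \<in> topspace X" "b \<in> topspace X" "a \<noteq> b"
  obtains h where "embedding_map (top_of_set {0..1::real}) X h" "h 0 = a" "h 1 = b"
    "\<And>K. \<lbrakk>connectedin X K; a \<in> K; b \<in> K\<rbrakk> \<Longrightarrow> h ` {0..1} \<subseteq> K"
proof -
  have Xp: "connected_space X" "locally_connected_space X" "compact_space X" "metrizable_space X"
    and nocirc: "\<And>S. S \<subseteq> topspace X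
      \<Longrightarrow> \<not> subtopology X S homeomorphic_space top_of_set (sphere (0::complex) 1)"
    using X unfolding dendrite_def by auto
  have haus: "Hausdorff_space X" using Xp(4) metrizable_imp_Hausdorff_space by blast
  obtain f :: "'a \<Rightarrow> 'a discrete \<Rightarrow>\<^sub>C real" where f: "embedding_map X euclidean f"
    using compact_metrizable_embedding[OF Xp(3,4)] by blast
  define S where "S = f ` topspace X"
  have fh: "homeomorphic_map X (top_of_set S) f"
    using f by (simp add: embedding_map_def S_def)
  then obtain g where g: "homeomorphic_maps X (top_of_set S) f g"
    unfolding homeomorphic_map_maps by blast
  then have gc: "continuous_map (top_of_set S) X g" and fc: "continuous_map X (top_of_set S) f"
    and gf: "\<And>x. x \<in> topspace X \<Longrightarrow> g (f x) = x" and fg: "\<And>y. y \<in> S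
      \<Longrightarrow> f (g y) = y"
    unfolding homeomorphic_maps_def by auto
  have hs: "X homeomorphic_space top_of_set S"
    using g unfolding homeomorphic_space_def by blast
  have "compactin euclidean S" "connectedin euclidean S"
    using image_compactin[of X "topspace X" euclidean f] connectedin_continuous_map_image[of X euclidean f "topspace X"]
      homeomorphic_imp_continuous_map[OF fh] Xp(1,3)
    by (auto simp: S_def compact_space_def connectedin_topspace continuous_map_in_subtopology)
  then have "compact S" "connected S" by auto
  have lc: "locally_connected_space (top_of_set S)"
    using homeomorphic_locally_connected_space[OF hs] Xp(2) by simp
  have nocircS: "\<not> T homeomorphic sphere (0::complex) 1" if "T \<subseteq> S" for T
  proof
    assume T: "T homeomorphic sphere (0::complex) 1"
    have gT: "g ` T \<subseteq> topspace X" using gc that by (auto simp: continuous_map_def)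
    have "homeomorphic_map (subtopology (top_of_set S) T) (subtopology X (g ` T)) g"
    proof (rule homeomorphic_map_subtopologies_alt)
      show "homeomorphic_map (top_of_set S) X g"
        using g homeomorphic_map_maps homeomorphic_maps_sym by blast
    qed (use that gT fg in \<open>auto, metis subsetD\<close>)
    then have "subtopology X (g ` T) homeomorphic_space top_of_set T"
      using that by (metis homeomorphic_map_imp_homeomorphic_space homeomorphic_space_sym inf.absorb_iff2 subtopology_subtopology)
    also have "top_of_set T homeomorphic_space top_of_set (sphere (0::complex) 1)"
    proof -
      obtain u v where "homeomorphism T (sphere (0::complex) 1) u v"
        using T unfolding homeomorphic_def by blast
      then have "homeomorphic_maps (top_of_set T) (top_of_set (sphere (0::complex) 1)) u v"
        unfolding homeomorphism_def homeomorphic_maps_def by auto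
      then show ?thesis unfolding homeomorphic_space_def by blast
    qed
    finally show False using nocirc[OF gT] by blast
  qed
  have fab: "f a \<in> S" "f b \<in> S" "f a \<noteq> f b"
    using ab gf by (auto simp: S_def) metis
  obtain \<gamma> where \<gamma>: "arc \<gamma>" "path_image \<gamma> \<subseteq> S" "pathstart \<gamma> = f a"
    "pathfinish \<gamma> = f b"
    using connected_open_imp_arc[OF \<open>compact S\<close> lc _ \<open>connected S\<close> fab] by auto
  have \<gamma>S: "\<gamma> t \<in> S" if "t \<in> {0..1}" for t using \<gamma>(2) that by (auto simp: path_image_def)
  have "continuous_map (top_of_set {0..1}) (top_of_set S) \<gamma>"
    using \<gamma>(1) \<gamma>S by (auto simp: arc_def path_def)
  then have cont: "continuous_map (top_of_set {0..1}) X (g \<circ> \<gamma>)"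
    using gc continuous_map_compose by blast
  have inj: "inj_on (g \<circ> \<gamma>) {0..1}"
    using \<gamma>(1) \<gamma>S fg unfolding arc_def inj_on_def comp_def by metis
  have emb: "embedding_map (top_of_set {0..1}) X (g \<circ> \<gamma>)"
    by (rule continuous_imp_embedding_map[OF cont _ haus]) (use inj in \<open>auto simp: compact_space_subtopology\<close>)
  have ends: "(g \<circ> \<gamma>) 0 = a" "(g \<circ> \<gamma>) 1 = b"
    using \<gamma>(3,4) gf ab by (auto simp: pathstart_def pathfinish_def)
  show thesis
  proof (rule that[OF emb ends])
    fix K assume K: "connectedin X K" "a \<in> K" "b \<in> K"
    show "(g \<circ> \<gamma>) ` {0..1} \<subseteq> K"
    proof (rule ccontr)
      assume "\<not> (g \<circ> \<gamma>) ` {0..1} \<subseteq> K"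
      then obtain t where t: "t \<in> {0..1}" "g (\<gamma> t) \<notin> K" by force
      define c where "c = \<gamma> t"
      have KX: "K \<subseteq> topspace X" using K(1) connectedin_subset_topspace by blast
      have "connectedin (top_of_set S) (f ` K)"
        using K(1) fc connectedin_continuous_map_image by blast
      then have conn: "connected (f ` K)" by (simp add: connectedin_subtopology)
      have sub: "f ` K \<subseteq> S - {c}"
      proof
        fix y assume "y \<in> f ` K"
        then obtain x where x: "x \<in> K" "y = f x" by blast
        then have "g y = x" "y \<in> S" using KX gf by (auto simp: S_def)
        then show "y \<in> S - {c}" using x(1) t(2) by (auto simp: c_def)
      qed
      \<comment> \<open>\<open>K\<close> itself may contain no arcs. Its image is enlarged to a
        component of \<open>S - {c}\<close>, which is open in \<open>S\<close> by local
        connectedness and therefore arcwise connected.\<close>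
      define U where "U = connected_component_of_set (top_of_set (S - {c})) (f a)"
      have UK: "f ` K \<subseteq> U"
        unfolding U_def using conn sub K(2)
        by (intro connected_component_of_maximal) (auto simp: connectedin_subtopology)
      have "openin (top_of_set S) U"
      proof -
        have op: "openin (top_of_set S) (S - {c})"
          by (simp add: openin_delete)
        then have "locally_connected_space (subtopology (top_of_set S) (S - {c}))"
          using locally_connected_space_open_subset[OF lc] by blast
        then have "locally_connected_space (top_of_set (S - {c}))"
          by (simp add: subtopology_subtopology inf.absorb2)
        then have "openin (top_of_set (S - {c})) U"
          unfolding U_def by (rule openin_connected_component_of_locally_connected_space)
        then show ?thesis using op openin_trans by blast
      qed
      moreover have "connected U"
        using connectedin_connected_component_of[of "top_of_set (S - {c})" "f a"]
        by (simp add: U_def connectedin_subtopology)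
      ultimately obtain k where k: "arc k" "path_image k \<subseteq> U" "pathstart k = f a" "pathfinish k = f b"
        using connected_open_imp_arc[OF \<open>compact S\<close> lc _ _ _ _ fab(3)] UK K(2,3) by blast
      have US: "U \<subseteq> S - {c}" unfolding U_def
        using connected_component_of_subset_topspace[of "top_of_set (S - {c})"] by simp
      then have "\<gamma> t \<notin> path_image k" using k(2) c_def by blast
      then obtain T where "T \<subseteq> path_image \<gamma> \<union> path_image k" "T homeomorphic sphere (0::complex) 1"
        using two_arcs_contain_circle[OF \<gamma>(1) k(1) _ _ t(1)] \<gamma>(3,4) k(3,4) by metis
      then show False using nocircS[of T] \<gamma>(2) k(2) US by blast
    qed
  qed
qed

section \<open>Dendrites: intervals and complementary components\<close>

locale dendrite_space =
  fixes X :: "'a topology"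
  assumes dendrite: "dendrite X"
begin

abbreviation "T \<equiv> topspace X"

text \<open>The arc between two points, given as a hull so that no parametrisation has to be chosen.
  If \<open>a\<close> or \<open>b\<close> is outside \<open>T\<close>, the intersection runs over
  the empty family and is \<open>UNIV\<close>, so the endpoints belong to it in all cases.\<close>

definition interval :: "'a \<Rightarrow> 'a \<Rightarrow> 'a set" where
  "interval a b = \<Inter> {K. connectedin X K \<and> a \<in> K \<and> b \<in> K}"

definition comps :: "'a \<Rightarrow> 'a set set" where
  "comps p = connected_components_of (subtopology X (T - {p}))"

lemma connected_X: "connected_space X" and locally_connected_X: "locally_connected_space X"
  and compact_X: "compact_space X" and metrizable_X: "metrizable_space X" and nonempty_X: "T \<noteq> {}"
  using dendrite unfolding dendrite_def by auto

lemma Hausdorff_X: "Hausdorff_space X"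
  using metrizable_X metrizable_imp_Hausdorff_space by blast

lemma closedin_singleton: "p \<in> T \<Longrightarrow> closedin X {p}"
  by (simp add: Hausdorff_X closedin_Hausdorff_sing_eq)

lemma openin_delete: "\<lbrakk>openin X U; p \<in> T\<rbrakk> \<Longrightarrow> openin X (U - {p})"
  by (simp add: closedin_singleton openin_diff)

subsection \<open>Intervals\<close>

lemma interval_subset: "\<lbrakk>connectedin X K; a \<in> K; b \<in> K\<rbrakk> \<Longrightarrow> interval a b \<subseteq> K"
  by (auto simp: interval_def)

lemma endpoints_in_interval: "a \<in> interval a b" "b \<in> interval a b"
  by (auto simp: interval_def)

lemma interval_commute: "interval a b = interval b a"
  unfolding interval_def by meson

lemma interval_arc:
  assumes "a \<in> T" "b \<in> T" "a \<noteq> b"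
  obtains h where "embedding_map (top_of_set {0..1::real}) X h" "h 0 = a" "h 1 = b" "h ` {0..1} = interval a b"
proof -
  obtain h where h: "embedding_map (top_of_set {0..1::real}) X h" "h 0 = a" "h 1 = b"
    "\<And>K. \<lbrakk>connectedin X K; a \<in> K; b \<in> K\<rbrakk> \<Longrightarrow> h ` {0..1} \<subseteq> K"
    using dendrite_arc[OF dendrite assms] by blast
  have "continuous_map (top_of_set {0..1}) X h"
    using h(1) continuous_map_in_subtopology embedding_map_def homeomorphic_imp_continuous_map by blast
  then have "connectedin X (h ` {0..1})"
    using connectedin_continuous_map_image[of "top_of_set {0..1::real}" X h "{0..1}"]
    by (simp add: connectedin_subtopology)
  moreover have "a \<in> h ` {0..1}" "b \<in> h ` {0..1}" using h(2,3) by force+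
  ultimately have "h ` {0..1} = interval a b"
    using h(4) by (intro equalityI interval_subset) (auto simp: interval_def)
  then show thesis using that h by blast
qed

lemma interval_refl: "a \<in> T \<Longrightarrow> interval a a = {a}"
  using interval_subset[of "{a}" a a] endpoints_in_interval(1)[of a a] by (auto simp: connectedin_sing)

lemma interval_connected: 
  assumes "a \<in> T" "b \<in> T" shows "connectedin X (interval a b)"
proof (cases "a = b")
  case False
  obtain h where h: "embedding_map (top_of_set {0..1::real}) X h" "h 0 = a" "h 1 = b" "h ` {0..1} = interval a b"
    by (rule interval_arc[OF assms False])
  have "continuous_map (top_of_set {0..1}) X h"
    using h(1) continuous_map_in_subtopology embedding_map_def homeomorphic_imp_continuous_map by blast
  then show ?thesis
    using connectedin_continuous_map_image[of "top_of_set {0..1::real}" X h "{0..1}"] h(4)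
    by (simp add: connectedin_subtopology)
qed (use assms interval_refl in simp)

lemma interval_subset_T: "\<lbrakk>a \<in> T; b \<in> T\<rbrakk> \<Longrightarrow> interval a b \<subseteq> T"
  by (simp add: connectedin_subset_topspace interval_connected)

lemma interval_closed:
  assumes "a \<in> T" "b \<in> T" shows "closedin X (interval a b)"
proof (cases "a = b")
  case False
  obtain h where h: "embedding_map (top_of_set {0..1::real}) X h" "h 0 = a" "h 1 = b" "h ` {0..1} = interval a b"
    by (rule interval_arc[OF assms False])
  have "continuous_map (top_of_set {0..1}) X h"
    using h(1) continuous_map_in_subtopology embedding_map_def homeomorphic_imp_continuous_map by blast
  then have "compactin X (interval a b)"
    using image_compactin[of "top_of_set {0..1::real}" "{0..1}" X h] h(4)
    by (simp add: compactin_subtopology)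
  then show ?thesis using Hausdorff_X compactin_imp_closedin by blast
qed (use assms interval_refl closedin_singleton in simp)

lemma interval_midpoint:
  assumes "a \<in> T" "b \<in> T" "a \<noteq> b"
  obtains c where "c \<in> interval a b" "c \<noteq> a" "c \<noteq> b"
proof -
  obtain h where h: "embedding_map (top_of_set {0..1::real}) X h" "h 0 = a" "h 1 = b" "h ` {0..1} = interval a b"
    by (rule interval_arc[OF assms])
  have "inj_on h {0..1}"
    using h(1) by (auto simp: embedding_map_def dest: homeomorphic_imp_injective_map)
  then have "h (1/2) \<noteq> h 0" "h (1/2) \<noteq> h 1"
    using inj_onD[of h "{0..1}" "1/2" 0] inj_onD[of h "{0..1}" "1/2" 1] by auto
  moreover have "h (1/2) \<in> interval a b" using h(4) by force
  ultimately show thesis using that h(2,3) by metis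
qed

text \<open>Connectedness becomes convexity for \<open>interval\<close>, a condition that
  intersections inherit. For the converse, \<open>S\<close> is the union of the intervals issuing
  from one of its points.\<close>

lemma connectedin_iff_interval:
  "connectedin X S \<longleftrightarrow> S \<subseteq> T \<and>
    (\<forall>a\<in>S. \<forall>b\<in>S. interval a b \<subseteq> S)"
proof
  assume R: "S \<subseteq> T \<and> (\<forall>a\<in>S. \<forall>b\<in>S. interval a b \<subseteq> S)"
  show "connectedin X S"
  proof (cases "S = {}")
    case False
    then obtain a where a: "a \<in> S" by blast
    have "connectedin X (\<Union>b\<in>S. interval a b)"
      using R a interval_connected endpoints_in_interval(1)[of a] by (intro connectedin_Union) blast+
    moreover have "(\<Union>b\<in>S. interval a b) = S" using R a endpoints_in_interval(2) by blast
    ultimately show ?thesis by simp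
  qed simp
qed (use interval_subset connectedin_subset_topspace in blast)

lemma connectedin_Inter:
  assumes "\<F> \<noteq> {}" "\<And>K. K \<in> \<F> \<Longrightarrow> connectedin X K"
  shows "connectedin X (\<Inter>\<F>)"
  using assms unfolding connectedin_iff_interval by blast

lemma connectedin_Int: "\<lbrakk>connectedin X A; connectedin X B\<rbrakk> \<Longrightarrow> connectedin X (A \<inter> B)"
  using connectedin_Inter[of "{A, B}"] by auto

subsection \<open>Complements of points\<close>

lemma openin_complement_point: "p \<in> T \<Longrightarrow> openin X (T - {p})"
  by (rule openin_delete) simp_all

lemma components_open_subset:
  assumes "openin X U" "W \<in> connected_components_of (subtopology X U)"
  shows "openin X W" "connectedin X W" "W \<noteq> {}" "W \<subseteq> U"
proof -
  have "locally_connected_space (subtopology X U)"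
    using locally_connected_space_open_subset[OF locally_connected_X assms(1)] .
  then have "openin (subtopology X U) W"
    using assms(2) openin_connected_components_of_locally_connected_space by blast
  then show "openin X W" using assms(1) openin_trans_full by blast
  show "connectedin X W" using connectedin_connected_components_of[OF assms(2)] by (simp add: connectedin_subtopology)
  show "W \<noteq> {}" using nonempty_connected_components_of[OF assms(2)] .
  show "W \<subseteq> U" using connected_components_of_subset[OF assms(2)] by auto
qed

lemma component_maximal:
  assumes "W \<in> connected_components_of (subtopology X U)" "connectedin X K" "K \<subseteq> U" "K \<inter> W \<noteq> {}"
  shows "K \<subseteq> W"
  using connected_components_of_maximal[OF assms(1), of K] assms(2-4)
  by (auto simp: connectedin_subtopology disjnt_def)

lemma ex_component: 
  assumes "U \<subseteq> T" "x \<in> U" shows "\<exists>W\<in>connected_components_of (subtopology X U). x \<in> W"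
  using Union_connected_components_of[of "subtopology X U"] assms by auto

text \<open>What is left over is the union of the other components, and these are open by local
  connectedness.\<close>

lemma complement_component_closed:
  assumes "openin X U" "W \<in> connected_components_of (subtopology X U)"
  shows "closedin X ((T - U) \<union> W)"
proof -
  have "T - ((T - U) \<union> W) = \<Union> (connected_components_of (subtopology X U) - {W})"
  proof -
    have "U \<subseteq> T" using assms(1) openin_subset by blast
    moreover have "V \<inter> W = {}" if "V \<in> connected_components_of (subtopology X U)" "V \<noteq> W" for V
      using that assms(2) pairwise_disjoint_connected_components_of[of "subtopology X U"]
      by (auto simp: pairwise_def disjnt_def)
    ultimately show ?thesis
      using Union_connected_components_of[of "subtopology X U"] connected_components_of_subset[of _ "subtopology X U"]
      by (auto simp: inf.absorb2)
  qed
  moreover have "openin X (\<Union> (connected_components_of (subtopology X U) - {W}))"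
    using components_open_subset(1)[OF assms(1)] by blast
  moreover have "(T - U) \<union> W \<subseteq> T"
    using components_open_subset(4)[OF assms] assms(1) openin_subset by blast
  ultimately show ?thesis by (simp add: closedin_def)
qed

lemma comps_open: "\<lbrakk>p \<in> T; C \<in> comps p\<rbrakk> \<Longrightarrow> openin X C"
  and comps_connected: "\<lbrakk>p \<in> T; C \<in> comps p\<rbrakk> \<Longrightarrow> connectedin X C"
  and comps_nonempty: "\<lbrakk>p \<in> T; C \<in> comps p\<rbrakk> \<Longrightarrow> C \<noteq> {}"
  and comps_subset: "\<lbrakk>p \<in> T; C \<in> comps p\<rbrakk> \<Longrightarrow> C \<subseteq> T - {p}"
  using components_open_subset[OF openin_complement_point] unfolding comps_def by blast+

lemma comps_notin: "\<lbrakk>p \<in> T; C \<in> comps p\<rbrakk> \<Longrightarrow> p \<notin> C"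
  using comps_subset by blast

lemma comps_maximal: "\<lbrakk>C \<in> comps p; connectedin X K; p \<notin> K; K \<inter> C \<noteq> {}\<rbrakk>
  \<Longrightarrow> K \<subseteq> C"
  unfolding comps_def
  by (erule component_maximal) (auto dest: connectedin_subset_topspace)

lemma ex_comps: "\<lbrakk>x \<in> T; x \<noteq> p\<rbrakk> \<Longrightarrow> \<exists>C\<in>comps p. x \<in> C"
  unfolding comps_def by (rule ex_component) auto

lemma comps_disjoint: "\<lbrakk>C \<in> comps p; D \<in> comps p; C \<noteq> D\<rbrakk> \<Longrightarrow> C \<inter> D = {}"
  using pairwise_disjoint_connected_components_of[of "subtopology X (T - {p})"]
  unfolding comps_def by (auto simp: pairwise_def disjnt_def)

text \<open>The closure cannot reach other components. Were it also disjoint from the complement of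
  \<open>U\<close>, then \<open>W\<close> would be clopen in a connected space.\<close>

lemma closure_component:
  assumes "openin X U" "U \<noteq> T" "W \<in> connected_components_of (subtopology X U)"
  shows "X closure_of W \<subseteq> (T - U) \<union> W" "(X closure_of W) \<inter> (T - U) \<noteq> {}"
proof -
  note W = components_open_subset[OF assms(1,3)]
  have UT: "U \<subseteq> T" using assms(1) openin_subset by blast
  show sub: "X closure_of W \<subseteq> (T - U) \<union> W"
    by (intro closure_of_minimal complement_component_closed assms) auto
  show "(X closure_of W) \<inter> (T - U) \<noteq> {}"
  proof
    assume "(X closure_of W) \<inter> (T - U) = {}"
    then have "X closure_of W = W"
      using sub closure_of_subset[of W X] W(4) UT by blast
    then have "closedin X W" by (metis closedin_closure_of)
    then have "W = T" using W(1,3) connected_X connected_space_clopen_in by metis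
    then show False using W(4) UT assms(2) by blast
  qed
qed

lemma closure_comps:
  assumes "p \<in> T" "C \<in> comps p" shows "X closure_of C = insert p C"
proof -
  have "X closure_of C \<subseteq> (T - (T - {p})) \<union> C" "(X closure_of C) \<inter> (T - (T - {p})) \<noteq> {}"
    using closure_component[OF openin_complement_point[OF assms(1)]] assms unfolding comps_def by blast+
  moreover have "T - (T - {p}) = {p}" using assms(1) by blast
  moreover have "C \<subseteq> X closure_of C"
    using comps_subset[OF assms] by (intro closure_of_subset) blast
  ultimately show ?thesis by blast
qed

lemma insert_comps: 
  assumes "p \<in> T" "C \<in> comps p"
  shows "closedin X (insert p C)" "connectedin X (insert p C)"
  using closure_comps[OF assms] closedin_closure_of[of X C] 
    connectedin_closure_of[OF comps_connected[OF assms]] by auto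

text \<open>Writes \<open>T - C\<close> as a union of connected sets through \<open>p\<close>, which
  makes it a subdendrite.\<close>

lemma complement_comps_eq: 
  assumes "p \<in> T" "C \<in> comps p"
  shows "T - C = (\<Union>D\<in>comps p - {C}. insert p D) \<union> {p}"
proof -
  have "x \<in> (\<Union>D\<in>comps p - {C}. insert p D) \<union> {p}" if x: "x \<in> T - C" for x
  proof (cases "x = p")
    case False
    then obtain D where "D \<in> comps p" "x \<in> D" using ex_comps x by blast
    then show ?thesis using x by blast
  qed simp
  moreover have "insert p D \<subseteq> T - C" if D: "D \<in> comps p" "D \<noteq> C" for D
    using comps_disjoint[OF D(1) assms(2) D(2)] comps_subset[OF assms(1) D(1)]
      comps_notin[OF assms] assms(1) by auto
  moreover have "p \<in> T - C" using assms comps_notin by simp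
  ultimately show ?thesis by blast
qed

lemma complement_comps:
  assumes "p \<in> T" "C \<in> comps p"
  shows "closedin X (T - C)" "connectedin X (T - C)" "p \<in> T - C"
proof -
  show "closedin X (T - C)" using comps_open[OF assms] by blast
  have "connectedin X (\<Union>(insert {p} (insert p ` (comps p - {C}))))"
    using assms insert_comps(2)[OF assms(1)] by (intro connectedin_Union) auto
  then show "connectedin X (T - C)"
    unfolding complement_comps_eq[OF assms] by (simp add: Un_commute)
  show "p \<in> T - C" using assms comps_notin by blast
qed

lemma subdendrite_complement_comps:
  assumes "p \<in> T" "C \<in> comps p" shows "subdendrite X (T - C)" "T - C \<noteq> T"
  using complement_comps[OF assms] comps_nonempty[OF assms] comps_subset[OF assms] unfolding subdendrite_def by blast+

lemma interval_separates:
  assumes "C \<in> comps p" "p \<in> interval a b" "a \<in> C" "p \<in> T"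
  shows "b \<notin> C"
  using interval_subset[OF comps_connected[OF assms(4,1)]] assms comps_notin by blast

lemma separated_in_interval:
  assumes "C \<in> comps p" "a \<in> C" "b \<in> T" "b \<notin> C" "p \<in> T"
  shows "p \<in> interval a b"
proof (rule ccontr)
  assume "p \<notin> interval a b"
  moreover have "a \<in> T" using assms comps_subset by blast
  ultimately have "interval a b \<subseteq> C"
    using assms interval_connected endpoints_in_interval(1)[of a b]
    by (intro comps_maximal[OF assms(1)]) auto
  then show False using assms endpoints_in_interval(2) by blast
qed

lemma separating_point:
  assumes "a \<in> T" "b \<in> T" "a \<noteq> b"
  obtains p A B where "p \<in> T" "A \<in> comps p" "B \<in> comps p" "a \<in> A" "b \<in> B" "A \<inter> B = {}"
proof -
  obtain p where p: "p \<in> interval a b" "p \<noteq> a" "p \<noteq> b" by (rule interval_midpoint[OF assms])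
  have pT: "p \<in> T" using p(1) interval_subset_T assms by blast
  obtain A B where AB: "A \<in> comps p" "a \<in> A" "B \<in> comps p" "b \<in> B" 
    using ex_comps assms p(2,3) by metis
  then have "A \<noteq> B" using interval_separates[OF AB(1) p(1) AB(2) pT] by blast
  then show thesis using that pT AB comps_disjoint by metis
qed

text \<open>Two boundary points of \<open>W\<close> in \<open>Y\<close> would be separated by a
  point \<open>p\<close>. Connectedness of \<open>Y\<close> puts \<open>p\<close> into
  \<open>Y\<close>, so the connected set \<open>W\<close> avoids \<open>p\<close> and yet meets both
  sides.\<close>

lemma component_boundary:
  assumes "closedin X Y" "connectedin X Y" "Y \<noteq> {}"
    and W: "W \<in> connected_components_of (subtopology X (T - Y))"
  obtains y where "y \<in> Y" "X closure_of W = insert y W"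
proof -
  have op: "openin X (T - Y)" using assms(1) by blast
  have YT: "Y \<subseteq> T" using assms(1) closedin_subset by blast
  have *: "T - (T - Y) = Y" "T - Y \<noteq> T" using YT assms(3) by auto
  have cl: "X closure_of W \<subseteq> Y \<union> W" "(X closure_of W) \<inter> Y \<noteq> {}"
    using closure_component[OF op *(2) W] *(1) by auto
  note W' = components_open_subset[OF op W]
  obtain y where y: "y \<in> X closure_of W" "y \<in> Y" using cl(2) by blast
  have "z = y" if z: "z \<in> X closure_of W" "z \<in> Y" for z
  proof (rule ccontr)
    assume "z \<noteq> y"
    then obtain p A B where p: "p \<in> T" "A \<in> comps p" "B \<in> comps p" "y \<in> A" "z \<in> B" "A \<inter> B = {}"
      using separating_point[of y z] y(2) z(2) YT by (metis subsetD)
    have "p \<in> Y"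
    proof (rule ccontr)
      assume "p \<notin> Y"
      then have "Y \<subseteq> A" using comps_maximal[OF p(2) assms(2)] y(2) p(4) by blast
      then show False using z(2) p(5,6) by blast
    qed
    then have "p \<notin> W" using W'(4) by blast
    have "W \<inter> A \<noteq> {}" "W \<inter> B \<noteq> {}"
      using y(1) z(1) p(4,5) comps_open[OF p(1)] p(2,3) unfolding in_closure_of by blast+
    then have "W \<subseteq> A" "W \<subseteq> B"
      using comps_maximal[OF _ W'(2) \<open>p \<notin> W\<close>] p(2,3) by blast+
    then show False using W'(3) p(6) by blast
  qed
  moreover have "W \<subseteq> X closure_of W" using W'(4) by (intro closure_of_subset) blast
  ultimately have "X closure_of W = insert y W" using cl(1) y by blast
  then show thesis using that y(2) by blast
qed

subsection \<open>Branch points and free arcs\<close>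

lemma branch_pointI:
  assumes "p \<in> T" "C \<in> comps p" "D \<in> comps p" "E \<in> comps p" "C \<noteq> D" "C \<noteq> E" "D \<noteq> E"
  shows "p \<in> branch_points X"
proof -
  have "card {C, D, E} = 3" using assms by auto
  moreover have "{C, D, E} \<subseteq> comps p" using assms by auto
  ultimately have "infinite (comps p) \<or> card (comps p) \<ge> 3" by (metis card_mono)
  then show ?thesis using assms(1) unfolding branch_points_def comps_def Let_def by auto
qed

lemma branch_pointE:
  assumes "p \<in> branch_points X" "C \<in> comps p"
  obtains D E where "p \<in> T" "D \<in> comps p" "E \<in> comps p" "C \<noteq> D" "C \<noteq> E" "D \<noteq> E"
proof -
  have p: "p \<in> T" "infinite (comps p) \<or> card (comps p) \<ge> 3"
    using assms(1) unfolding branch_points_def comps_def Let_def by auto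
  then have "infinite (comps p - {C}) \<or> card (comps p - {C}) \<ge> 2"
    using assms(2) by (auto simp: card_Diff_singleton)
  then obtain F where "F \<subseteq> comps p - {C}" "card F = 2"
    by (meson infinite_arbitrarily_large obtain_subset_with_card_n)
  then obtain D E where "{D, E} \<subseteq> comps p - {C}" "D \<noteq> E" by (metis card_2_iff)
  then show thesis using that p(1) by blast
qed

lemma branch_pointE_ex:
  assumes "p \<in> branch_points X"
  obtains C where "p \<in> T" "C \<in> comps p"
proof -
  have p: "p \<in> T" "infinite (comps p) \<or> card (comps p) \<ge> 3"
    using assms unfolding branch_points_def comps_def Let_def by auto
  then have "comps p \<noteq> {}" by auto
  then show thesis using that p(1) by blast
qed

text \<open>Everything outside the interval hangs at single points of it, and hanging at an interior
  point would make that a branch point. So near an interior point \<open>p\<close> only the interval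
  is left once both ends, with all that is attached to them, are cut off.\<close>

lemma interval_interior_open:
  assumes ab: "a \<in> T" "b \<in> T" "a \<noteq> b"
    and nb: "\<And>p. \<lbrakk>p \<in> interval a b; p \<noteq> a; p \<noteq> b\<rbrakk>
      \<Longrightarrow> p \<notin> branch_points X"
  shows "openin X (interval a b - {a, b})"
proof -
  let ?J = "interval a b"
  have JT: "?J \<subseteq> T" by (rule interval_subset_T[OF ab(1,2)])
  have attach: "y' \<in> {a, b}" if W: "W \<in> connected_components_of (subtopology X (T - ?J))" 
      and y': "y' \<in> ?J" "X closure_of W = insert y' W" for W y'
  proof (rule ccontr)
    assume ne: "y' \<notin> {a, b}"
    have y'T: "y' \<in> T" using y'(1) JT by blast
    have op: "openin X (T - ?J)" using interval_closed[OF ab(1,2)] by blast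
    note W' = components_open_subset[OF op W]
    obtain A B where AB: "A \<in> comps y'" "a \<in> A" "B \<in> comps y'" "b \<in> B" using ex_comps ab ne
      by (metis insertCI)
    have "A \<noteq> B" using interval_separates[OF AB(1) y'(1) AB(2) y'T] AB(4) by blast
    obtain w where w: "w \<in> W" using W'(3) by blast
    have "w \<noteq> y'" "w \<in> T" using w W'(4) y'(1) by auto
    then obtain E where E: "E \<in> comps y'" "w \<in> E" using ex_comps by metis
    \<comment> \<open>The closure of \<open>W\<close> adds only \<open>y'\<close>, so
      \<open>E \<inter> W\<close> is clopen in \<open>E\<close>. Hence \<open>E\<close> lies off the
      interval and is a third component at \<open>y'\<close> besides those of \<open>a\<close> and
      \<open>b\<close>.\<close>
    have "E \<subseteq> W"
    proof (rule ccontr)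
      assume "\<not> E \<subseteq> W"
      have "E \<inter> X closure_of W = E \<inter> W" using y'(2) comps_notin[OF y'T E(1)] by simp
      then have "closedin (subtopology X E) (E \<inter> W)"
        by (metis closedin_closure_of closedin_subtopology_Int_closed)
      moreover have "openin (subtopology X E) (E \<inter> W)"
        using W'(1) by (simp add: openin_subtopology_Int2)
      moreover have "connected_space (subtopology X E)"
        using comps_connected[OF y'T E(1)] connectedin_def by blast
      ultimately have "E \<inter> W = {} \<or> E \<inter> W = topspace (subtopology X E)"
        by (metis connected_space_clopen_in)
      then show False using w E(2) \<open>\<not> E \<subseteq> W\<close> comps_subset[OF y'T E(1)] by auto
    qed
    then have "a \<notin> E" "b \<notin> E"
      using W'(4) endpoints_in_interval(1)[of a b] endpoints_in_interval(2)[of b a] by auto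
    then have "A \<noteq> E" "B \<noteq> E" using AB(2,4) by auto
    then have "y' \<in> branch_points X"
      using branch_pointI[OF y'T AB(1,3) E(1) \<open>A \<noteq> B\<close>] by simp
    then show False using nb y'(1) ne by blast
  qed
  show ?thesis
    unfolding openin_subopen[of X "?J - {a, b}"]
  proof
    fix p assume p: "p \<in> ?J - {a, b}"
    then have pT: "p \<in> T" using JT by blast
    \<comment> \<open>Cut points strictly between \<open>p\<close> and either end; the components
      \<open>P\<close> and \<open>Q\<close> that contain \<open>p\<close> exclude \<open>a\<close>
      and \<open>b\<close> respectively.\<close>
    obtain a' where a': "a' \<in> interval a p" "a' \<noteq> a" "a' \<noteq> p" using p
      by (auto intro: interval_midpoint[OF ab(1) pT])
    obtain b' where b': "b' \<in> interval b p" "b' \<noteq> b" "b' \<noteq> p" using p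
      by (auto intro: interval_midpoint[OF ab(2) pT])
    have sub: "interval a p \<subseteq> ?J" "interval b p \<subseteq> ?J"
      using interval_subset[OF interval_connected[OF ab(1,2)]] p endpoints_in_interval by auto
    have T': "a' \<in> T" "b' \<in> T" using sub a' b' JT by auto
    obtain P Q where PQ: "P \<in> comps a'" "p \<in> P" "Q \<in> comps b'" "p \<in> Q"
      using ex_comps pT a'(3) b'(3) by metis
    have nP: "a \<notin> P" "b \<notin> Q"
      using interval_separates[OF PQ(1) _ PQ(2) T'(1), of a] interval_separates[OF PQ(3) _ PQ(4) T'(2), of b]
        a'(1) b'(1) by (auto simp: interval_commute)
    have "P \<inter> Q \<subseteq> ?J - {a, b}"
    proof
      fix y assume y: "y \<in> P \<inter> Q"
      then have yT: "y \<in> T" using comps_subset[OF T'(1) PQ(1)] by blast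
      have "y \<in> ?J"
      proof (rule ccontr)
        assume "y \<notin> ?J"
        then obtain W where W: "W \<in> connected_components_of (subtopology X (T - ?J))" "y \<in> W"
          using ex_component[of "T - ?J" y] yT by auto
        obtain y' where y': "y' \<in> ?J" "X closure_of W = insert y' W"
          using component_boundary[OF interval_closed[OF ab(1,2)] interval_connected[OF ab(1,2)] _ W(1)]
            endpoints_in_interval by blast
        have op: "openin X (T - ?J)" using interval_closed[OF ab(1,2)] by blast
        note W' = components_open_subset[OF op W(1)]
        have conn: "connectedin X (insert y' W)"
          using connectedin_closure_of[OF W'(2)] y'(2) by simp
        have "y' = a \<or> y' = b" using attach[OF W(1) y'] by blast
        then show False
        proof
          assume "y' = a"
          then have "a' \<notin> insert y' W" using a' sub W'(4) by blast
          then have "insert y' W \<subseteq> P" using comps_maximal[OF PQ(1) conn] y W(2) by blast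
          then show False using nP \<open>y' = a\<close> by blast
        next
          assume "y' = b"
          then have "b' \<notin> insert y' W" using b' sub W'(4) by blast
          then have "insert y' W \<subseteq> Q" using comps_maximal[OF PQ(3) conn] y W(2) by blast
          then show False using nP \<open>y' = b\<close> by blast
        qed
      qed
      then show "y \<in> ?J - {a, b}" using y nP by blast
    qed
    moreover have "openin X (P \<inter> Q)" using comps_open T' PQ by blast
    ultimately show "\<exists>U. openin X U \<and> p \<in> U \<and> U \<subseteq> ?J - {a, b}" using PQ by blast
  qed
qed

lemma free_arc_interval:
  assumes ab: "a \<in> T" "b \<in> T" "a \<noteq> b"
    and nb: "\<And>p. \<lbrakk>p \<in> interval a b; p \<noteq> a; p \<noteq> b\<rbrakk>
      \<Longrightarrow> p \<notin> branch_points X"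
  shows "free_arc X (interval a b)"
proof -
  obtain h where h: "embedding_map (top_of_set {0..1::real}) X h" "h 0 = a" "h 1 = b" "h ` {0..1} = interval a b"
    by (rule interval_arc[OF ab])
  then show ?thesis
    unfolding free_arc_def using interval_interior_open[OF ab nb] by (metis (no_types, lifting))
qed

text \<open>The inverse parametrisation maps the hull of the ends to a connected subset of
  \<open>[0,1]\<close> containing 0 and 1, so this hull is all of \<open>A\<close>. An interior
  point cuts \<open>A\<close> into only two connected pieces, too few for three components.\<close>

lemma free_arcE:
  assumes "free_arc X A"
  obtains a b where "a \<in> T" "b \<in> T" "a \<noteq> b" "A = interval a b" "openin X (A - {a, b})"
    "\<And>p. p \<in> A - {a, b} \<Longrightarrow> p \<notin> branch_points X"
proof -
  obtain h where h: "embedding_map (top_of_set {0..1::real}) X h" "A = h ` {0..1}" "openin X (A - {h 0, h 1})"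
    using assms unfolding free_arc_def by blast
  have hom: "homeomorphic_map (top_of_set {0..1}) (subtopology X A) h"
    using h(1,2) unfolding embedding_map_def by simp
  have cont: "continuous_map (top_of_set {0..1}) X h"
    using hom continuous_map_in_subtopology homeomorphic_imp_continuous_map by blast
  have inj: "inj_on h {0..1}" using hom by (auto dest: homeomorphic_imp_injective_map)
  have AT: "A \<subseteq> T" using cont h(2) by (auto simp: continuous_map_def)
  have im: "connectedin X (h ` S)" if "connected S" "S \<subseteq> {0..1}" for S
    using connectedin_continuous_map_image[OF cont, of S] that by (simp add: connectedin_subtopology)
  have ends: "h 0 \<in> A" "h 1 \<in> A" using h(2) by auto
  have ne: "h 0 \<noteq> h 1" using inj by (metis inj_on_contraD atLeastAtMost_iff order_refl zero_le_one zero_neq_one)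
  obtain g where "homeomorphic_maps (top_of_set {0..1}) (subtopology X A) h g"
    using hom homeomorphic_map_maps by blast
  then have g: "continuous_map (subtopology X A) (top_of_set {0..1}) g" "\<And>t. t \<in> {0..1}
    \<Longrightarrow> g (h t) = t"
     "\<And>y. y \<in> A \<Longrightarrow> h (g y) = y"
    using AT unfolding homeomorphic_maps_def by auto
  have eqA: "A = interval (h 0) (h 1)"
  proof
    show "interval (h 0) (h 1) \<subseteq> A"
      using im[of "{0..1}"] h(2) ends by (intro interval_subset) auto
    show "A \<subseteq> interval (h 0) (h 1)"
    proof
      fix y assume y: "y \<in> A"
      have "connectedin (subtopology X A) (interval (h 0) (h 1))"
        using \<open>interval (h 0) (h 1) \<subseteq> A\<close> interval_connected AT ends
          by (simp add: connectedin_subtopology subset_iff)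
      then have "connectedin (top_of_set {0..1}) (g ` interval (h 0) (h 1))"
        using connectedin_continuous_map_image[OF g(1)] by blast
      then have "connected (g ` interval (h 0) (h 1))" by (simp add: connectedin_subtopology)
      moreover have "0 \<in> g ` interval (h 0) (h 1)" "1 \<in> g ` interval (h 0) (h 1)"
        using endpoints_in_interval g(2)[of 0] g(2)[of 1] by (metis atLeastAtMost_iff imageI order_refl zero_le_one)+
      moreover have "g y \<in> {0..1}" using g(1) y AT by (auto simp: continuous_map_def)
      ultimately have "g y \<in> g ` interval (h 0) (h 1)"
        by (metis atLeastAtMost_iff connectedD_interval)
      then obtain z where "z \<in> interval (h 0) (h 1)" "g y = g z" by blast
      then show "y \<in> interval (h 0) (h 1)"
        using g(3) y \<open>interval (h 0) (h 1) \<subseteq> A\<close> by (metis subsetD)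
    qed
  qed
  have nbr: "p \<notin> branch_points X" if p: "p \<in> A - {h 0, h 1}" for p
  proof
    assume br: "p \<in> branch_points X"
    obtain C where C: "p \<in> T" "C \<in> comps p" by (rule branch_pointE_ex[OF br])
    obtain D E where "p \<in> T" and DE: "D \<in> comps p" "E \<in> comps p" "C \<noteq> D" "C \<noteq> E" "D \<noteq> E"
      by (rule branch_pointE[OF br C(2)])
    obtain s where s: "s \<in> {0..1}" "p = h s" using p h(2) by blast
    define L where "L = h ` {0..<s}"
    define R where "R = h ` {s<..1}"
    have "{0..1} = insert s ({0..<s} \<union> {s<..1})" using s(1) by auto
    then have A: "A = insert p (L \<union> R)" unfolding h(2) L_def R_def s(2) by (metis image_Un image_insert)
    have pLR: "p \<notin> L" "p \<notin> R" using s(1) by (auto simp: L_def R_def s(2) dest!: inj_onD[OF inj])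
    have cLR: "connectedin X L" "connectedin X R" unfolding L_def R_def using s(1) by (intro im; auto)+
    \<comment> \<open>\<open>p\<close> is in the closure of each component \<open>F\<close> at
      \<open>p\<close>, so \<open>F\<close> meets the open interior of the arc and swallows one of
      the two pieces.\<close>
    have "L \<subseteq> F \<and> L \<noteq> {} \<or> R \<subseteq> F \<and> R \<noteq> {}" if F: "F \<in> comps p" for F
    proof -
      have "p \<in> X closure_of F" using closure_comps[OF C(1) F] by simp
      then obtain z where z: "z \<in> F" "z \<in> A - {h 0, h 1}"
        using h(3) p unfolding in_closure_of by metis
      then have "z \<in> L \<union> R" using A z(1) comps_notin[OF C(1) F] by auto
      then show ?thesis using comps_maximal[OF F cLR(1) pLR(1)] comps_maximal[OF F cLR(2) pLR(2)] z(1)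
        by (metis Un_iff disjoint_iff empty_iff)
    qed
    note * = this[OF C(2)] this[OF DE(1)] this[OF DE(2)]
    have "C \<inter> D = {}" "C \<inter> E = {}" "D \<inter> E = {}" using comps_disjoint C(2) DE by blast+
    then show False using * by blast
  qed
  have "h 0 \<in> T" "h 1 \<in> T" using ends AT by auto
  then show thesis by (rule that[OF _ _ ne eqA h(3) nbr])
qed


subsection \<open>Families of subdendrites\<close>

lemma subdendrite_simps: 
  assumes "subdendrite X Y" shows "Y \<noteq> {}" "closedin X Y" "connectedin X Y" "Y \<subseteq> T"
  using assms closedin_subset unfolding subdendrite_def by auto

lemma subdendrite_T: "subdendrite X T"
  using connected_X nonempty_X by (simp add: subdendrite_def connectedin_topspace)

lemma subdendrite_Int: "\<lbrakk>subdendrite X A; subdendrite X B; A \<inter> B \<noteq> {}\<rbrakk>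
  \<Longrightarrow> subdendrite X (A \<inter> B)"
  unfolding subdendrite_def using connectedin_Int by blast

text \<open>\<open>A \<inter> (B \<union> C)\<close> is connected and covered by the closed
  non-empty sets \<open>A \<inter> B\<close> and \<open>A \<inter> C\<close>, which therefore meet.
  This is the base of the Helly property.\<close>

lemma subdendrites_Int3:
  assumes "subdendrite X A" "subdendrite X B" "subdendrite X C"
    and "A \<inter> B \<noteq> {}" "A \<inter> C \<noteq> {}" "B \<inter> C \<noteq> {}"
  shows "A \<inter> B \<inter> C \<noteq> {}"
proof
  assume "A \<inter> B \<inter> C = {}"
  note s = subdendrite_simps[OF assms(1)] subdendrite_simps[OF assms(2)] subdendrite_simps[OF assms(3)]
  have "connectedin X (B \<union> C)" using s assms(6) by (intro connectedin_Un) auto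
  then have "connectedin X (A \<inter> (B \<union> C))" using s(3) connectedin_Int by blast
  moreover have "closedin X (A \<inter> B)" "closedin X (A \<inter> C)" using s by auto
  moreover have "A \<inter> (B \<union> C) \<subseteq> (A \<inter> B) \<union> (A \<inter> C)" by blast
  moreover have "(A \<inter> B) \<inter> (A \<inter> C) \<inter> (A \<inter> (B \<union> C)) = {}"
    using \<open>A \<inter> B \<inter> C = {}\<close> by blast
  ultimately show False
    using assms(4,5) unfolding connectedin_closedin by blast
qed

lemma subdendrites_finite_Inter:
  assumes "finite \<F>" "\<F> \<noteq> {}" "\<And>A. A \<in> \<F> \<Longrightarrow> subdendrite X A"
    and "\<And>A B. \<lbrakk>A \<in> \<F>; B \<in> \<F>\<rbrakk> \<Longrightarrow> A \<inter> B \<noteq> {}"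
  shows "subdendrite X (\<Inter>\<F>)"
proof -
  \<comment> \<open>The claim is strengthened so that the induction hypothesis tells that the
    intersection of the earlier members meets the next one.\<close>
  have "subdendrite X (\<Inter>\<F>) \<and>
    (\<forall>C. subdendrite X C \<longrightarrow> (\<forall>A\<in>\<F>. A \<inter> C \<noteq> {}) \<longrightarrow> \<Inter>\<F> \<inter> C \<noteq> {})"
    using assms
  proof (induction \<F> rule: finite_ne_induct)
    case (singleton A)
    then show ?case by auto
  next
    case (insert A \<F>)
    have IH: "subdendrite X (\<Inter>\<F>)"
      "\<And>C. \<lbrakk>subdendrite X C; \<forall>B\<in>\<F>. B \<inter> C \<noteq> {}\<rbrakk>
        \<Longrightarrow> \<Inter>\<F> \<inter> C \<noteq> {}"
      using insert.IH insert.prems by auto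
    have A: "subdendrite X A" "\<Inter>\<F> \<inter> A \<noteq> {}" using IH(2)[of A] insert.prems by auto
    have "subdendrite X (A \<inter> \<Inter>\<F>)" using subdendrite_Int[OF A(1) IH(1)] A(2) by (simp add: Int_commute)
    moreover have "A \<inter> \<Inter>\<F> \<inter> C \<noteq> {}" if C: "subdendrite X C"
      "\<forall>B\<in>insert A \<F>. B \<inter> C \<noteq> {}" for C
    proof (rule subdendrites_Int3[OF A(1) IH(1) C(1)])
      show "A \<inter> \<Inter>\<F> \<noteq> {}" using A(2) by (simp add: Int_commute)
      show "A \<inter> C \<noteq> {}" using C(2) by blast
      show "\<Inter>\<F> \<inter> C \<noteq> {}" using IH(2)[OF C(1)] C(2) by blast
    qed
    ultimately show ?case by simp
  qed
  then show ?thesis ..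
qed

text \<open>Compactness carries non-emptiness from finite subfamilies to arbitrary families.\<close>

lemma subdendrites_Inter:
  assumes "\<F> \<noteq> {}" "\<And>A. A \<in> \<F> \<Longrightarrow> subdendrite X A"
    and "\<And>A B. \<lbrakk>A \<in> \<F>; B \<in> \<F>\<rbrakk> \<Longrightarrow> A \<inter> B \<noteq> {}"
  shows "subdendrite X (\<Inter>\<F>)"
proof -
  have "\<Inter>\<F> \<noteq> {}"
  proof -
    have "\<Inter>\<G> \<noteq> {}" if "finite \<G>" "\<G> \<subseteq> \<F>" for \<G>
    proof (cases "\<G> = {}")
      case False
      then have "subdendrite X (\<Inter>\<G>)"
        using that assms by (intro subdendrites_finite_Inter) (auto simp: subset_iff)
      then show ?thesis by (rule subdendrite_simps)
    qed simp
    moreover have "\<forall>A\<in>\<F>. closedin X A" using assms(2) subdendrite_simps(2) by blast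
    ultimately show ?thesis using compact_X unfolding compact_space_fip by metis
  qed
  moreover have "closedin X (\<Inter>\<F>)" using assms(1,2) subdendrite_simps(2) by (intro closedin_Inter) auto
  moreover have "connectedin X (\<Inter>\<F>)" using assms(1,2) subdendrite_simps(3) by (intro connectedin_Inter) auto
  ultimately show ?thesis unfolding subdendrite_def by blast
qed

text \<open>Only finitely many members of a disjoint family contain one of the finitely many points used to
  separate \<open>y\<close> from the complement of \<open>V\<close>; the other members do not leave \<open>V\<close> once they come close to \<open>y\<close>.\<close>

lemma disjoint_connected_null:
  fixes C :: "nat \<Rightarrow> 'a set"
  assumes disj: "\<And>j k. j \<noteq> k \<Longrightarrow> C j \<inter> C k = {}" and conn: "\<And>k. connectedin X (C k)"
    and V: "openin X V" "y \<in> V"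
  obtains W J where "openin X W" "y \<in> W" "finite J"
    "\<And>k. \<lbrakk>k \<notin> J; C k \<inter> W \<noteq> {}\<rbrakk> \<Longrightarrow> C k \<subseteq> V"
proof -
  have yT: "y \<in> T" using V openin_subset by blast
  have "\<exists>p A B. p \<in> T \<and> A \<in> comps p \<and> B \<in> comps p \<and> y \<in> A \<and>
    z \<in> B \<and> A \<inter> B = {}" if "z \<in> T - V" for z
    using separating_point[of y z] yT that V(2) by (metis Diff_iff)
  then obtain p A B where pAB: "\<And>z. z \<in> T - V \<Longrightarrow> p z \<in> T \<and>
    A z \<in> comps (p z) \<and> B z \<in> comps (p z) \<and> y \<in> A z \<and> z \<in> B z \<and> A z \<inter> B z = {}"
    by metis
  have "closedin X (T - V)" using V(1) by blast
  then have "compactin X (T - V)" using compact_X closedin_compact_space by blast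
  moreover have "\<forall>U\<in>B ` (T - V). openin X U" using pAB comps_open by blast
  moreover have "T - V \<subseteq> \<Union>(B ` (T - V))" using pAB by blast
  ultimately obtain \<G> where "finite \<G>" "\<G> \<subseteq> B ` (T - V)" "T - V \<subseteq> \<Union>\<G>"
    unfolding compactin_def by meson
  then obtain Z where Z: "finite Z" "Z \<subseteq> T - V" "T - V \<subseteq> (\<Union>z\<in>Z. B z)"
    by (metis finite_subset_image)
  define W where "W = T \<inter> (\<Inter>z\<in>Z. A z)"
  define J where "J = (\<Union>z\<in>Z. {k. p z \<in> C k})"
  have A: "openin X (A z)" "y \<in> A z" if "z \<in> Z" for z
    using pAB[of z] comps_open[of "p z" "A z"] that Z(2) by auto
  show thesis
  proof (rule that[of W J])
    show "openin X W"
    proof (cases "Z = {}")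
      case False
      then have "openin X (\<Inter>z\<in>Z. A z)" using A(1) Z(1) by (intro openin_Inter) auto
      then show ?thesis unfolding W_def by blast
    qed (simp add: W_def)
    show "y \<in> W" using A(2) yT by (simp add: W_def)
    have "finite {k. q \<in> C k}" for q
    proof -
      have "\<exists>k0. {k. q \<in> C k} \<subseteq> {k0}"
        using disj by (metis (no_types, lifting) disjoint_iff mem_Collect_eq singletonI subsetI)
      then show ?thesis using finite_subset by blast
    qed
    then show "finite J" using Z(1) by (simp add: J_def)
    fix k assume k: "k \<notin> J" "C k \<inter> W \<noteq> {}"
    show "C k \<subseteq> V"
    proof (rule ccontr)
      assume "\<not> C k \<subseteq> V"
      moreover have "C k \<subseteq> T" using conn connectedin_subset_topspace by blast
      ultimately obtain x z where x: "x \<in> C k" "z \<in> Z" "x \<in> B z" using Z(3) by blast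
      have z: "z \<in> T - V" using x(2) Z(2) by blast
      have "p z \<notin> C k" using k(1) x(2) by (simp add: J_def)
      moreover have "C k \<inter> A z \<noteq> {}" using k(2) x(2) by (auto simp: W_def)
      ultimately have "C k \<subseteq> A z"
        using comps_maximal[OF _ conn, of "A z" "p z"] pAB[OF z] by blast
      then show False using x(1,3) pAB[OF z] by blast
    qed
  qed
qed

subsection \<open>The homeomorphism group\<close>

abbreviation "G \<equiv> homeo_group X"

lemma carrier_G: "g \<in> carrier G \<longleftrightarrow> g \<in> Bij T \<and> homeomorphic_map X X g"
  by (simp add: homeo_group_def)

lemma carrier_GI:
  assumes "continuous_map X X f" "continuous_map X X f'"
    and "\<And>x. x \<in> T \<Longrightarrow> f' (f x) = x" "\<And>x. x \<in> T \<Longrightarrow> f (f' x) = x"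
  shows "restrict f T \<in> carrier G"
proof -
  have "homeomorphic_maps X X f f'"
    using assms by (simp add: homeomorphic_maps_def)
  then have hom: "homeomorphic_map X X f" using homeomorphic_map_maps by blast
  then have "homeomorphic_map X X (restrict f T)"
    by (rule homeomorphic_map_eq) auto
  moreover from hom have "bij_betw f T T"
    by (simp add: bij_betw_def homeomorphic_imp_injective_map homeomorphic_imp_surjective_map)
  then have "restrict f T \<in> Bij T" by (simp add: Bij_def)
  ultimately show ?thesis by (simp add: carrier_G)
qed

lemma subgroup_homeo: "subgroup {g \<in> Bij T. homeomorphic_map X X g} (BijGroup T)"
proof (rule group.subgroupI[OF group_BijGroup])
  show "{g \<in> Bij T. homeomorphic_map X X g} \<subseteq> carrier (BijGroup T)" by (auto simp: BijGroup_def)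
  have "restrict id T \<in> carrier G" by (rule carrier_GI[of _ id]) auto
  then show "{g \<in> Bij T. homeomorphic_map X X g} \<noteq> {}" unfolding carrier_G by blast
next
  fix g assume "g \<in> {g \<in> Bij T. homeomorphic_map X X g}"
  then have g: "g \<in> Bij T" "homeomorphic_map X X g" by auto
  then obtain g' where g': "homeomorphic_maps X X g g'" using homeomorphic_map_maps by blast
  have "restrict g' T \<in> carrier G"
    using g' by (intro carrier_GI[of _ g]) (auto simp: homeomorphic_maps_def)
  moreover have "inv\<^bsub>BijGroup T\<^esub> g = restrict g' T"
    unfolding inv_BijGroup[OF g(1)]
  proof (rule restrict_ext)
    fix x assume x: "x \<in> T"
    then have "g (g' x) = x" "g' x \<in> T" using g' by (auto simp: homeomorphic_maps_def continuous_map_def)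
    then show "inv_into T g x = g' x"
      using g(1) by (metis Bij_def IntE bij_betw_def inv_into_f_f mem_Collect_eq)
  qed
  ultimately show "inv\<^bsub>BijGroup T\<^esub> g \<in> {g \<in> Bij T. homeomorphic_map X X g}" unfolding carrier_G by simp
next
  fix g h assume "g \<in> {g \<in> Bij T. homeomorphic_map X X g}" "h \<in> {g \<in> Bij T. homeomorphic_map X X g}"
  then have gh: "g \<in> Bij T" "h \<in> Bij T" "homeomorphic_map X X g" "homeomorphic_map X X h" by auto
  have "homeomorphic_map X X (g \<circ> h)" using gh homeomorphic_map_compose by blast
  then have "homeomorphic_map X X (compose T g h)"
    by (rule homeomorphic_map_eq) (simp add: compose_def)
  then show "g \<otimes>\<^bsub>BijGroup T\<^esub> h \<in> {g \<in> Bij T. homeomorphic_map X X g}"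
    using gh by (simp add: BijGroup_def compose_Bij)
qed

lemma group_G: "group G"
  unfolding homeo_group_def using subgroup.subgroup_is_group[OF subgroup_homeo group_BijGroup] .

sublocale G: group G by (rule group_G)

lemma mult_apply: "\<lbrakk>g \<in> carrier G; h \<in> carrier G; x \<in> T\<rbrakk>
  \<Longrightarrow> (g \<otimes>\<^bsub>G\<^esub> h) x = g (h x)"
  by (simp add: homeo_group_def BijGroup_def compose_def)

lemma one_apply: "x \<in> T \<Longrightarrow> \<one>\<^bsub>G\<^esub> x = x"
  by (simp add: homeo_group_def BijGroup_def)

lemma bij_G: "g \<in> carrier G \<Longrightarrow> bij_betw g T T"
  by (simp add: carrier_G Bij_def)

lemma apply_T: "\<lbrakk>g \<in> carrier G; x \<in> T\<rbrakk> \<Longrightarrow> g x \<in> T"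
  using bij_betwE[OF bij_G] by simp

lemma inj_G: "g \<in> carrier G \<Longrightarrow> inj_on g T"
  using bij_betw_imp_inj_on[OF bij_G] .

lemma apply_eq_iff: "\<lbrakk>g \<in> carrier G; x \<in> T; y \<in> T\<rbrakk>
  \<Longrightarrow> g x = g y \<longleftrightarrow> x = y"
  by (rule inj_on_eq_iff[OF inj_G])

lemma image_T: "g \<in> carrier G \<Longrightarrow> g ` T = T"
  using bij_betw_imp_surj_on[OF bij_G] .

lemma inv_apply: 
  assumes "g \<in> carrier G" "x \<in> T" shows "(inv\<^bsub>G\<^esub> g) (g x) = x" "g ((inv\<^bsub>G\<^esub> g) x) = x"
  using assms mult_apply[of "(inv\<^bsub>G\<^esub> g)" g x] mult_apply[of g "(inv\<^bsub>G\<^esub> g)" x] one_apply by auto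

lemma G_eqI:
  assumes "g \<in> carrier G" "h \<in> carrier G" "\<And>x. x \<in> T \<Longrightarrow> g x = h x" shows "g = h"
  using assms unfolding carrier_G Bij_def by (auto intro: extensionalityI)

lemma image_mult:
  assumes "g \<in> carrier G" "h \<in> carrier G" "A \<subseteq> T" shows "(g \<otimes>\<^bsub>G\<^esub> h) ` A = g ` h ` A"
  unfolding image_image using assms mult_apply by (intro image_cong) auto

lemma image_inv:
  assumes "g \<in> carrier G" "A \<subseteq> T" shows "(inv\<^bsub>G\<^esub> g) ` g ` A = A"
    "g ` (inv\<^bsub>G\<^esub> g) ` A = A"
proof -
  have "(inv\<^bsub>G\<^esub> g) ` g ` A = id ` A" "g ` (inv\<^bsub>G\<^esub> g) ` A = id ` A"
    unfolding image_image using assms inv_apply by (intro image_cong; auto)+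
  then show "(inv\<^bsub>G\<^esub> g) ` g ` A = A" "g ` (inv\<^bsub>G\<^esub> g) ` A = A" by simp_all
qed

lemma image_sub: "\<lbrakk>g \<in> carrier G; A \<subseteq> T\<rbrakk> \<Longrightarrow> g ` A \<subseteq> T"
  using apply_T by blast

lemma homeo: "g \<in> carrier G \<Longrightarrow> homeomorphic_map X X g"
  by (simp add: carrier_G)

lemma cont: "g \<in> carrier G \<Longrightarrow> continuous_map X X g"
  by (simp add: carrier_G homeomorphic_imp_continuous_map)

lemma connectedin_image: "\<lbrakk>g \<in> carrier G; connectedin X A\<rbrakk> \<Longrightarrow> connectedin X (g ` A)"
  using cont connectedin_continuous_map_image by blast

lemma closedin_image: "\<lbrakk>g \<in> carrier G; closedin X A\<rbrakk> \<Longrightarrow> closedin X (g ` A)"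
  using homeomorphic_map_closedness_eq[OF homeo] by blast

lemma openin_image: "\<lbrakk>g \<in> carrier G; openin X A\<rbrakk> \<Longrightarrow> openin X (g ` A)"
  using homeomorphic_map_openness_eq[OF homeo] by blast

lemma closure_image: "\<lbrakk>g \<in> carrier G; A \<subseteq> T\<rbrakk>
  \<Longrightarrow> X closure_of (g ` A) = g ` (X closure_of A)"
  using homeomorphic_map_closure_of[OF homeo] by blast

lemma subdendrite_image: "\<lbrakk>g \<in> carrier G; subdendrite X Y\<rbrakk> \<Longrightarrow> subdendrite X (g ` Y)"
  unfolding subdendrite_def using connectedin_image closedin_image by blast

lemma image_interval:
  assumes g: "g \<in> carrier G" and ab: "a \<in> T" "b \<in> T"
  shows "g ` interval a b = interval (g a) (g b)"
proof
  have *: "interval (h x) (h y) \<subseteq> h ` interval x y" if "h \<in> carrier G" "x \<in> T" "y \<in> T" for h x y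
    using that connectedin_image interval_connected endpoints_in_interval by (intro interval_subset) auto
  show "interval (g a) (g b) \<subseteq> g ` interval a b" by (rule *[OF g ab])
  have "g ` interval ((inv\<^bsub>G\<^esub> g) (g a)) ((inv\<^bsub>G\<^esub> g) (g b)) \<subseteq> g ` (inv\<^bsub>G\<^esub> g) ` interval (g a) (g b)"
    using *[of "(inv\<^bsub>G\<^esub> g)" "g a" "g b"] g ab apply_T by (intro image_mono) auto
  then show "g ` interval a b \<subseteq> interval (g a) (g b)"
    using g ab inv_apply image_inv(2)[OF g interval_subset_T] apply_T by simp
qed

lemma comps_image:
  assumes g: "g \<in> carrier G" and p: "p \<in> T" and C: "C \<in> comps p"
  shows "g ` C \<in> comps (g p)"
proof -
  have gp: "g p \<in> T" using apply_T g p by blast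
  have CT: "C \<subseteq> T - {p}" using comps_subset p C by blast
  have "g p \<notin> g ` C" using inj_G[OF g] CT p by (auto simp: inj_on_def)
  obtain x where x: "x \<in> C" using comps_nonempty[OF p C] by blast
  have "g x \<in> T" "g x \<noteq> g p" using x CT p g apply_T apply_eq_iff by auto
  then obtain D where D: "D \<in> comps (g p)" "g x \<in> D" using ex_comps by metis
  have 1: "g ` C \<subseteq> D"
    using comps_maximal[OF D(1) connectedin_image[OF g comps_connected[OF p C]] \<open>g p \<notin> g ` C\<close>] D(2) x by blast
  have DT: "D \<subseteq> T - {g p}" using comps_subset gp D(1) by blast
  have "(inv\<^bsub>G\<^esub> g) ` D \<subseteq> C"
  proof (rule comps_maximal[OF C])
    show "connectedin X ((inv\<^bsub>G\<^esub> g) ` D)" using connectedin_image[OF _ comps_connected[OF gp D(1)]] g by simp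
    show "p \<notin> (inv\<^bsub>G\<^esub> g) ` D"
    proof
      assume "p \<in> (inv\<^bsub>G\<^esub> g) ` D"
      then obtain d where d: "d \<in> D" "p = (inv\<^bsub>G\<^esub> g) d" by blast
      then have "g p = d" using inv_apply(2)[OF g] DT by auto
      then show False using d(1) DT by blast
    qed
    have "(inv\<^bsub>G\<^esub> g) (g x) = x" using inv_apply(1)[OF g] x CT by blast
    then show "(inv\<^bsub>G\<^esub> g) ` D \<inter> C \<noteq> {}" using D(2) x by (metis disjoint_iff imageI)
  qed
  then have "D \<subseteq> g ` C" using image_inv(2)[OF g, of D] DT by blast
  then show ?thesis using 1 D(1) by auto
qed

lemma branch_image:
  assumes g: "g \<in> carrier G" and p: "p \<in> branch_points X"
  shows "g p \<in> branch_points X"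
proof -
  obtain C where C: "p \<in> T" "C \<in> comps p" by (rule branch_pointE_ex[OF p])
  obtain D E where "p \<in> T" and DE: "D \<in> comps p" "E \<in> comps p" "C \<noteq> D" "C \<noteq> E" "D \<noteq> E"
    by (rule branch_pointE[OF p C(2)])
  have inj: "g ` A = g ` B \<longleftrightarrow> A = B" if "A \<in> comps p" "B \<in> comps p" for A B
    using inj_on_image_eq_iff[OF inj_G[OF g], of A B] comps_subset[OF C(1)] that by blast
  show ?thesis
    by (rule branch_pointI[OF apply_T[OF g C(1)] comps_image[OF g C] comps_image[OF g C(1) DE(1)]
      comps_image[OF g C(1) DE(2)]])
       (use inj C DE in auto)
qed

lemma branch_T: "p \<in> branch_points X \<Longrightarrow> p \<in> T"
  by (simp add: branch_points_def)

text \<open>The frontier of a component at \<open>p\<close> is at most \<open>{p}\<close>, so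
  agreement at this one point suffices. This allows maps that act differently on the components at
  \<open>p\<close>.\<close>

lemma glue:
  assumes "p \<in> T" "C \<in> comps p" "continuous_map X X f" "continuous_map X X g" "f p = g p"
  shows "continuous_map X X (\<lambda>x. if x \<in> C then f x else g x)"
proof (rule continuous_map_cases)
  show "continuous_map (subtopology X (X closure_of {x. x \<in> C})) X f"
    using assms(3) continuous_map_from_subtopology by blast
  show "continuous_map (subtopology X (X closure_of {x. x \<notin> C})) X g"
    using assms(4) continuous_map_from_subtopology by blast
  fix x assume "x \<in> X frontier_of {x. x \<in> C}"
  then have "x \<in> X closure_of C - X interior_of C" by (simp add: frontier_of_def)
  then have "x = p"
    using closure_comps[OF assms(1,2)] interior_of_openin[OF comps_open[OF assms(1,2)]] by auto
  then show "f x = g x" using assms(5) by simp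
qed


subsection \<open>Rigid stabilisers generate the stabilisers of branch points\<close>

text \<open>Such an \<open>f\<close> is supported in \<open>T - C\<close>, a proper subdendrite and
  hence a set that a minimal group can displace from itself.\<close>

definition rigid :: "('a \<Rightarrow> 'a) \<Rightarrow> 'a \<Rightarrow> 'a set \<Rightarrow> bool" where
  "rigid f p C \<longleftrightarrow> f \<in> carrier G \<and> p \<in> branch_points X \<and> C \<in> comps p \<and>
    (\<forall>x\<in>C. f x = x)"

text \<open>The first factor acts as \<open>g\<close> on a component \<open>C\<close> and as its inverse on \<open>g ` C\<close>; it fixes a third
  component because \<open>p\<close> is a branch point.\<close>

lemma stabilizer_rigid_decomposition:
  assumes g: "g \<in> carrier G" and p: "p \<in> branch_points X" "g p = p"
  obtains s t C D where "rigid s p C" "rigid t p D" "g = s \<otimes>\<^bsub>G\<^esub> t"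
proof -
  obtain C where C: "p \<in> T" "C \<in> comps p" by (rule branch_pointE_ex[OF p(1)])
  obtain D E where "p \<in> T" and DE: "D \<in> comps p" "E \<in> comps p" "C \<noteq> D" "C \<noteq> E" "D \<noteq> E"
    by (rule branch_pointE[OF p(1) C(2)])
  define C' where "C' = g ` C"
  have C': "C' \<in> comps p" unfolding C'_def using comps_image[OF g C] p(2) by simp
  \<comment> \<open>At most one of \<open>D\<close> and \<open>E\<close> equals \<open>C'\<close>;
    the other one is the third component left alone.\<close>
  obtain F where F: "F \<in> comps p" "F \<noteq> C" "F \<noteq> C'" using DE by metis
  let ?g' = "inv\<^bsub>G\<^esub> g"
  have g': "?g' \<in> carrier G" using g by simp
  have g'p: "?g' p = p" using inv_apply(1)[OF g C(1)] p(2) by simp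
  \<comment> \<open>The order of the tests matters when \<open>C' = C\<close>: then \<open>s\<close>
    acts on \<open>C\<close> by \<open>g\<close> and \<open>s'\<close> by its inverse, so the two
    remain inverse to each other.\<close>
  define s where "s x = (if x \<in> C then g x else if x \<in> C' then ?g' x else x)" for x
  define s' where "s' x = (if x \<in> C' then ?g' x else if x \<in> C then g x else x)" for x
  have CT: "C \<subseteq> T" "C' \<subseteq> T" using comps_subset C C' by auto
  have gC: "g x \<in> C'" if "x \<in> C" for x using that by (simp add: C'_def)
  have g'C: "?g' x \<in> C" "g (?g' x) = x" if "x \<in> C'" for x
    using that inv_apply[OF g] CT unfolding C'_def by auto
  have gg: "?g' (g x) = x" if "x \<in> C" for x using that inv_apply[OF g] CT by auto
  have disj: "C = C' \<or> C \<inter> C' = {}" using comps_disjoint[OF C(2) C'] by blast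
  have ss': "s' (s x) = x" "s (s' x) = x" for x
  proof -
    have "s' (s x) = x \<and> s (s' x) = x"
    proof (cases "C = C'")
      case True
      then show ?thesis using gC g'C gg unfolding s_def s'_def by auto
    next
      case False
      then have "\<And>x. x \<in> C' \<Longrightarrow> x \<notin> C" using disj by blast
      then show ?thesis using gC g'C gg unfolding s_def s'_def by auto
    qed
    then show "s' (s x) = x" "s (s' x) = x" by simp_all
  qed
  have pC: "p \<notin> C" "p \<notin> C'" using comps_notin C C' by auto
  have ident: "continuous_map X X (\<lambda>x. x)" by simp
  have cs: "continuous_map X X s"
    unfolding s_def using p(2) g'p pC
    by (intro glue[OF C] glue[OF C(1) C'] cont g g' ident) auto
  have cs': "continuous_map X X s'"
    unfolding s'_def using p(2) g'p pC
    by (intro glue[OF C] glue[OF C(1) C'] cont g g' ident) auto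
  define r where "r = restrict s T"
  have r: "r \<in> carrier G" unfolding r_def by (rule carrier_GI[OF cs cs' ss'])
  have "rigid r p F"
    unfolding rigid_def
  proof (intro conjI ballI)
    fix x assume "x \<in> F"
    then have "x \<notin> C" "x \<notin> C'" "x \<in> T"
      using comps_disjoint[OF F(1) C(2) F(2)] comps_disjoint[OF F(1) C' F(3)] comps_subset[OF C(1) F(1)] by auto
    then show "r x = x" by (simp add: r_def s_def)
  qed (use r p F in auto)
  moreover have "rigid (inv\<^bsub>G\<^esub> r \<otimes>\<^bsub>G\<^esub> g) p C"
    unfolding rigid_def
  proof (intro conjI ballI)
    fix x assume x: "x \<in> C"
    then have xT: "x \<in> T" using CT by auto
    have "g x = r x" using x xT by (simp add: r_def s_def)
    then show "(inv\<^bsub>G\<^esub> r \<otimes>\<^bsub>G\<^esub> g) x = x"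
      using mult_apply[of "inv\<^bsub>G\<^esub> r" g x] r g xT inv_apply(1)[OF r xT] by simp
  qed (use r g p C in auto)
  moreover have "g = r \<otimes>\<^bsub>G\<^esub> (inv\<^bsub>G\<^esub> r \<otimes>\<^bsub>G\<^esub> g)"
    using r g by (simp flip: G.m_assoc)
  ultimately show thesis by (rule that)
qed

abbreviation "K \<equiv> carrier (G_Br X)"

lemma K_eq: "K = generate G (\<Union>x\<in>branch_points X. stabilizer G (\<lambda>g. g) x)"
  by (simp add: G_Br_def)

lemma stabilizers_subset: "(\<Union>x\<in>branch_points X. stabilizer G (\<lambda>g. g) x) \<subseteq> carrier G"
  by (auto simp: stabilizer_def)

lemma subgroup_K: "subgroup K G"
  unfolding K_eq by (rule G.generate_is_subgroup[OF stabilizers_subset])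

lemma stabilizer_in_K: "\<lbrakk>g \<in> carrier G; p \<in> branch_points X; g p = p\<rbrakk> \<Longrightarrow> g \<in> K"
  unfolding K_eq by (rule generate.incl) (auto simp: stabilizer_def)

lemma K_subset_if_rigid:
  assumes N: "subgroup N G" and rigid: "\<And>f p C. rigid f p C \<Longrightarrow> f \<in> N"
  shows "K \<subseteq> N"
  unfolding K_eq
proof (rule G.generate_subgroup_incl[OF _ N])
  show "(\<Union>x\<in>branch_points X. stabilizer G (\<lambda>g. g) x) \<subseteq> N"
  proof
    fix g assume "g \<in> (\<Union>x\<in>branch_points X. stabilizer G (\<lambda>g. g) x)"
    then obtain p where "p \<in> branch_points X" "g \<in> carrier G" "g p = p"
      by (auto simp: stabilizer_def)
    then obtain s t C D where "rigid s p C" "rigid t p D" "g = s \<otimes>\<^bsub>G\<^esub> t"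
      by (meson stabilizer_rigid_decomposition)
    then show "g \<in> N" using rigid subgroup.m_closed[OF N] by blast
  qed
qed

text \<open>Conjugation by \<open>g\<close> turns the stabiliser of \<open>p\<close> into that of
  \<open>g p\<close>, again a branch point, so the generators are closed under conjugation by all of
  \<open>G\<close>.\<close>

lemma K_conj:
  assumes "g \<in> carrier G" "k \<in> K"
    shows "g \<otimes>\<^bsub>G\<^esub> k \<otimes>\<^bsub>G\<^esub> inv\<^bsub>G\<^esub> g \<in> K"
proof -
  have "K \<lhd> G" unfolding K_eq
  proof (rule G.normal_generateI[OF stabilizers_subset])
    fix h g assume h: "h \<in> (\<Union>x\<in>branch_points X. stabilizer G (\<lambda>g. g) x)" and g: "g \<in> carrier G"
    then obtain p where p: "p \<in> branch_points X" "h \<in> carrier G" "h p = p"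
      by (auto simp: stabilizer_def)
    have pT: "p \<in> T" using branch_T p(1) by blast
    have "(g \<otimes>\<^bsub>G\<^esub> h \<otimes>\<^bsub>G\<^esub> inv\<^bsub>G\<^esub> g) (g p) = g p"
      using g p pT apply_T inv_apply(1)[OF g pT] by (simp add: mult_apply)
    then show "g \<otimes>\<^bsub>G\<^esub> h \<otimes>\<^bsub>G\<^esub> inv\<^bsub>G\<^esub> g \<in> (\<Union>x\<in>branch_points X. stabilizer G (\<lambda>g. g) x)"
      using branch_image[OF g p(1)] g p(2) by (auto simp: stabilizer_def)
  qed
  then show ?thesis using normal.inv_op_closed2 assms by metis
qed

subsection \<open>Minimal actions\<close>

definition minimal :: "('a \<Rightarrow> 'a) set \<Rightarrow> bool" where
  "minimal H \<longleftrightarrow> (\<forall>Y. subdendrite X Y \<longrightarrow> (\<forall>g\<in>H. g ` Y = Y) \<longrightarrow> Y = T)"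

lemma minimal_G_iff: "minimal (carrier G) \<longleftrightarrow> dendro_minimal X"
  unfolding minimal_def dendro_minimal_def by auto

lemma invariantI:
  assumes H: "subgroup H G" and Z: "Z \<subseteq> T" "\<And>h. h \<in> H
    \<Longrightarrow> h ` Z \<subseteq> Z" and h: "h \<in> H"
  shows "h ` Z = Z"
proof
  have hG: "h \<in> carrier G" using H h subgroup.subset by blast
  have "(inv\<^bsub>G\<^esub> h) ` Z \<subseteq> Z" using Z(2) subgroup.m_inv_closed[OF H h] by blast
  then have "h ` (inv\<^bsub>G\<^esub> h) ` Z \<subseteq> h ` Z" by blast
  then show "Z \<subseteq> h ` Z" using image_inv(2)[OF hG Z(1)] by simp
qed (use assms in blast)

definition subdendrite_hull :: "'a set \<Rightarrow> 'a set" where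
  "subdendrite_hull S = \<Inter> {Y. closedin X Y \<and> connectedin X Y \<and> S \<subseteq> Y}"

lemma subdendrite_hull:
  assumes "S \<subseteq> T" shows "S \<subseteq> subdendrite_hull S" "closedin X (subdendrite_hull S)"
    "connectedin X (subdendrite_hull S)"
proof -
  let ?F = "{Y. closedin X Y \<and> connectedin X Y \<and> S \<subseteq> Y}"
  have "T \<in> ?F" using connected_X assms by (simp add: connectedin_topspace)
  then have ne: "?F \<noteq> {}" by blast
  show "S \<subseteq> subdendrite_hull S" by (auto simp: subdendrite_hull_def)
  show "closedin X (subdendrite_hull S)" unfolding subdendrite_hull_def using ne by (intro closedin_Inter) auto
  show "connectedin X (subdendrite_hull S)" unfolding subdendrite_hull_def using ne by (intro connectedin_Inter) auto
qed

lemma subdendrite_hull_minimal: "\<lbrakk>closedin X Y; connectedin X Y; S \<subseteq> Y\<rbrakk>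
  \<Longrightarrow> subdendrite_hull S \<subseteq> Y"
  by (auto simp: subdendrite_hull_def)

text \<open>The subdendrite hull of an invariant set is invariant, hence all of \<open>T\<close>;
  but if \<open>S\<close> missed \<open>C\<close>, the hull would stay in the subdendrite
  \<open>T - C\<close>. Later \<open>S\<close> is a set of fixed points or the set of branch
  points.\<close>

lemma invariant_set_meets_comps:
  assumes H: "subgroup H G" "minimal H" and S: "S \<subseteq> T" "S \<noteq> {}" "\<And>h. h \<in> H
    \<Longrightarrow> h ` S \<subseteq> S"
    and p: "p \<in> T" "C \<in> comps p"
  shows "S \<inter> C \<noteq> {}"
proof
  assume "S \<inter> C = {}"
  note hS = subdendrite_hull[OF S(1)]
  have "subdendrite_hull S \<subseteq> T" using hS(2) closedin_subset by blast
  have "h ` subdendrite_hull S = subdendrite_hull S" if h: "h \<in> H" for h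
  proof (rule invariantI[OF H(1) \<open>subdendrite_hull S \<subseteq> T\<close> _ h])
    fix h assume h: "h \<in> H"
    then have hG: "h \<in> carrier G" and h'H: "inv\<^bsub>G\<^esub> h \<in> H"
      using H subgroup.subset subgroup.m_inv_closed[OF H(1)] by blast+
    then have h'G: "inv\<^bsub>G\<^esub> h \<in> carrier G" by simp
    \<comment> \<open>The preimage of the hull under \<open>h\<close> is closed, connected and
      contains \<open>S\<close>, so it is one of the sets intersected in the hull.\<close>
    have "subdendrite_hull S \<subseteq> (inv\<^bsub>G\<^esub> h) ` subdendrite_hull S"
    proof (rule subdendrite_hull_minimal)
      show "closedin X ((inv\<^bsub>G\<^esub> h) ` subdendrite_hull S)" using closedin_image[OF h'G hS(2)] .
      show "connectedin X ((inv\<^bsub>G\<^esub> h) ` subdendrite_hull S)" using connectedin_image[OF h'G hS(3)] .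
      have "(inv\<^bsub>G\<^esub> h) ` S = S" using invariantI[OF H(1) S(1,3) h'H] .
      then show "S \<subseteq> (inv\<^bsub>G\<^esub> h) ` subdendrite_hull S" using hS(1) by blast
    qed
    then have "h ` subdendrite_hull S \<subseteq> h ` (inv\<^bsub>G\<^esub> h) ` subdendrite_hull S" by blast
    then show "h ` subdendrite_hull S \<subseteq> subdendrite_hull S"
      using image_inv(2)[OF hG \<open>subdendrite_hull S \<subseteq> T\<close>] by simp
  qed
  moreover have "subdendrite X (subdendrite_hull S)" using hS S(2) unfolding subdendrite_def by blast
  ultimately have "subdendrite_hull S = T" using H(2) unfolding minimal_def by blast
  moreover have "subdendrite_hull S \<subseteq> T - C"
    using complement_comps[OF p] \<open>S \<inter> C = {}\<close> S(1) by (intro subdendrite_hull_minimal) auto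
  ultimately show False using comps_nonempty[OF p] comps_subset[OF p] by blast
qed

text \<open>\<open>m h = h m'\<close> for the conjugate \<open>m'\<close> of \<open>m\<close> by the
  inverse of \<open>h\<close>, in the two forms used later: on sets and on points.\<close>

lemma normalized_image:
  assumes M: "subgroup M G" and H: "subgroup H G"
    and norm: "\<And>h m. \<lbrakk>h \<in> H; m \<in> M\<rbrakk>
      \<Longrightarrow> h \<otimes>\<^bsub>G\<^esub> m \<otimes>\<^bsub>G\<^esub> inv\<^bsub>G\<^esub> h \<in> M"
    and h: "h \<in> H" "m \<in> M" and Y: "Y \<subseteq> T"
  shows "\<exists>m'\<in>M. m ` h ` Y = h ` m' ` Y \<and> (\<forall>x\<in>T. m (h x) = h (m' x))"
proof -
  have hG: "h \<in> carrier G" and mG: "m \<in> carrier G" and h': "inv\<^bsub>G\<^esub> h \<in> H"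
    using H M h subgroup.subset subgroup.m_inv_closed[OF H] by blast+
  define m' where "m' = inv\<^bsub>G\<^esub> h \<otimes>\<^bsub>G\<^esub> m \<otimes>\<^bsub>G\<^esub> h"
  have "m' \<in> M" using norm[OF h' h(2)] hG by (simp add: m'_def)
  moreover have *: "m (h x) = h (m' x)" if "x \<in> T" for x
    using that hG mG apply_T inv_apply(2)[OF hG] by (simp add: m'_def mult_apply)
  moreover have "m ` h ` Y = h ` m' ` Y"
    unfolding image_image using * Y by (intro image_cong) auto
  ultimately show ?thesis by blast
qed

text \<open>A fixed point of \<open>M\<close> would make every branch point, as the median of three fixed points, fixed. Without
  fixed points, invariant subdendrites meet, as otherwise the point where one is attached to the other
  is fixed; so there is a smallest one, and it is invariant under \<open>H\<close>.\<close>

lemma normalized_subgroup_minimal: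
  assumes M: "subgroup M G" and H: "subgroup H G" "minimal H"
    and norm: "\<And>h m. \<lbrakk>h \<in> H; m \<in> M\<rbrakk>
      \<Longrightarrow> h \<otimes>\<^bsub>G\<^esub> m \<otimes>\<^bsub>G\<^esub> inv\<^bsub>G\<^esub> h \<in> M"
    and m0: "m0 \<in> M" "q \<in> branch_points X" "m0 q \<noteq> q"
  shows "minimal M"
proof -
  have MG: "m \<in> carrier G" if "m \<in> M" for m using that M subgroup.subset by blast
  have HG: "h \<in> carrier G" if "h \<in> H" for h using that H subgroup.subset by blast
  have qT: "q \<in> T" using m0(2) branch_T by blast
  have conj: "\<exists>m'\<in>M. m ` h ` Y = h ` m' ` Y \<and> (\<forall>x\<in>T. m (h x) = h (m' x))"
    if "h \<in> H" "m \<in> M" "Y \<subseteq> T" for h m Y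
    by (rule normalized_image[OF M H(1) _ that]) (rule norm)
  define Fix where "Fix = {x \<in> T. \<forall>m\<in>M. m x = x}"
  have "Fix = {}"
  proof (rule ccontr)
    assume ne: "Fix \<noteq> {}"
    have inv: "h ` Fix \<subseteq> Fix" if h: "h \<in> H" for h
    proof (rule image_subsetI)
      fix x assume x: "x \<in> Fix"
      have "m (h x) = h x" if m: "m \<in> M" for m
      proof -
        \<comment> \<open>Only the pointwise clause is wanted, so the empty set stands in for
          \<open>Y\<close>.\<close>
        obtain m' where m': "m' \<in> M" "m (h x) = h (m' x)"
          using conj[OF h m, of "{}"] x unfolding Fix_def by auto
        then have "m' x = x" using x by (simp add: Fix_def)
        then show ?thesis using m'(2) by simp
      qed
      then show "h x \<in> Fix" using x apply_T[OF HG[OF h]] by (simp add: Fix_def)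
    qed
    have meets: "Fix \<inter> C \<noteq> {}" if "C \<in> comps q" for C
      using invariant_set_meets_comps[OF H _ ne inv qT that] by (auto simp: Fix_def)
    have m0q: "m0 q \<in> T" using apply_T[OF MG[OF m0(1)] qT] .
    \<comment> \<open>\<open>m0 q\<close> lies in \<open>D\<close>. Fixed points \<open>e\<close>
      and \<open>f\<close> in two other components have \<open>q\<close> between them, hence also
      \<open>m0 q\<close>; but \<open>interval e f\<close> stays in \<open>E\<close>,
      \<open>F\<close> and \<open>q\<close>.\<close>
    then obtain D where D: "D \<in> comps q" "m0 q \<in> D" using ex_comps m0(3) by metis
    obtain E F where "q \<in> T" and EF: "E \<in> comps q" "F \<in> comps q" "D \<noteq> E" "D \<noteq> F" "E \<noteq> F"
      by (rule branch_pointE[OF m0(2) D(1)])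
    obtain e f where ef: "e \<in> E" "f \<in> F" "e \<in> Fix" "f \<in> Fix" using meets EF(1,2) by blast
    have efT: "e \<in> T" "f \<in> T" "m0 e = e" "m0 f = f" using ef m0(1) by (auto simp: Fix_def)
    have "f \<notin> E" using comps_disjoint[OF EF(1,2,5)] ef(2) by blast
    then have "q \<in> interval e f" using separated_in_interval[OF EF(1) ef(1) efT(2) _ qT] by blast
    then have "m0 q \<in> interval e f"
      using image_interval[OF MG[OF m0(1)] efT(1,2)] efT(3,4) by (metis imageI)
    moreover have "interval e f \<subseteq> insert q E \<union> insert q F"
      using insert_comps(2)[OF qT] EF ef(1,2) by (intro interval_subset connectedin_Un) auto
    ultimately have "m0 q \<in> E \<or> m0 q \<in> F" using m0(3) by blast
    then show False using D(2) comps_disjoint[OF D(1) EF(1,3)] comps_disjoint[OF D(1) EF(2,4)] by blast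
  qed
  define \<F> where "\<F> = {Y. subdendrite X Y \<and> (\<forall>m\<in>M. m ` Y = Y)}"
  have meet: "Y1 \<inter> Y2 \<noteq> {}" if Y: "Y1 \<in> \<F>" "Y2 \<in> \<F>" for Y1 Y2
  proof
    assume disj: "Y1 \<inter> Y2 = {}"
    note Y1 = subdendrite_simps[of Y1] note Y2 = subdendrite_simps[of Y2]
    have s: "subdendrite X Y1" "subdendrite X Y2" using Y by (auto simp: \<F>_def)
    obtain z where z: "z \<in> Y2" using Y2(1)[OF s(2)] by blast
    have Y2sub: "Y2 \<subseteq> T - Y1" using disj Y2(4)[OF s(2)] by blast
    then obtain W where W: "W \<in> connected_components_of (subtopology X (T - Y1))" "z \<in> W"
      using ex_component[of "T - Y1" z] z by blast
    have Y2W: "Y2 \<subseteq> W"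
      using component_maximal[OF W(1) Y2(3)[OF s(2)] Y2sub] z W(2) by blast
    obtain y where y: "y \<in> Y1" "X closure_of W = insert y W"
      using component_boundary[OF Y1(2,3,1)[OF s(1)] W(1)] .
    have op: "openin X (T - Y1)" using Y1(2)[OF s(1)] by blast
    note W' = components_open_subset[OF op W(1)]
    \<comment> \<open>The image of \<open>W\<close> under \<open>m\<close> still contains the
      invariant set \<open>Y2\<close>, so it lies in \<open>W\<close>. Taking closures,
      \<open>m y\<close> is in \<open>insert y W\<close> and in \<open>Y1\<close>, which share only
      \<open>y\<close>.\<close>
    have "m y = y" if m: "m \<in> M" for m
    proof -
      have mG: "m \<in> carrier G" using MG m by blast
      have mY: "m ` Y1 = Y1" "m ` Y2 = Y2" using Y m by (auto simp: \<F>_def)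
      have "m ` W \<subseteq> m ` (T - Y1)" using W'(4) by blast
      also have "m ` (T - Y1) = T - Y1"
        using inj_on_image_set_diff[OF inj_G[OF mG], of T Y1] Y1(4)[OF s(1)] image_T[OF mG] mY(1) by auto
      finally have mW: "m ` W \<subseteq> T - Y1" .
      have "m ` W \<inter> W \<noteq> {}" using mY(2) Y2W z by blast
      then have "m ` W \<subseteq> W" by (rule component_maximal[OF W(1) connectedin_image[OF mG W'(2)] mW])
      then have "X closure_of (m ` W) \<subseteq> insert y W" using closure_of_mono[of "m ` W" W X] y(2) by simp
      then have "m ` insert y W \<subseteq> insert y W"
        using closure_image[OF mG, of W] W'(4) y(2) by auto
      moreover have "m y \<in> Y1" using mY(1) y(1) by blast
      ultimately show ?thesis using W'(4) by blast
    qed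
    then have "y \<in> Fix" using y(1) Y1(4)[OF s(1)] by (auto simp: Fix_def)
    then show False using \<open>Fix = {}\<close> by blast
  qed
  have TF: "T \<in> \<F>" using subdendrite_T image_T MG by (simp add: \<F>_def)
  define Z where "Z = \<Inter>\<F>"
  have Z: "subdendrite X Z"
    unfolding Z_def using TF meet by (intro subdendrites_Inter) (auto simp: \<F>_def)
  have ZT: "Z \<subseteq> T" using subdendrite_simps(4)[OF Z] .
  have "h ` Z \<subseteq> Z" if h: "h \<in> H" for h
  proof -
    have "h ` Z \<subseteq> Y" if Y: "Y \<in> \<F>" for Y
    proof -
      have h': "inv\<^bsub>G\<^esub> h \<in> H" using subgroup.m_inv_closed[OF H(1) h] .
      have YT: "Y \<subseteq> T" using Y subdendrite_simps(4) by (auto simp: \<F>_def)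
      have "m ` (inv\<^bsub>G\<^esub> h) ` Y = (inv\<^bsub>G\<^esub> h) ` Y" if m: "m \<in> M" for m
      proof -
        obtain m' where "m' \<in> M" "m ` (inv\<^bsub>G\<^esub> h) ` Y = (inv\<^bsub>G\<^esub> h) ` m' ` Y"
          using conj[OF h' m YT] by metis
        then show ?thesis using Y by (simp add: \<F>_def)
      qed
      then have "(inv\<^bsub>G\<^esub> h) ` Y \<in> \<F>" using subdendrite_image[OF HG[OF h']] Y by (simp add: \<F>_def)
      then have "Z \<subseteq> (inv\<^bsub>G\<^esub> h) ` Y" by (auto simp: Z_def)
      then have "h ` Z \<subseteq> h ` (inv\<^bsub>G\<^esub> h) ` Y" by blast
      then show ?thesis using image_inv(2)[OF HG[OF h] YT] by simp
    qed
    then show ?thesis by (auto simp: Z_def)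
  qed
  then have "\<forall>h\<in>H. h ` Z = Z" using invariantI[OF H(1) ZT] by blast
  \<comment> \<open>\<open>Z\<close> is contained in every subdendrite invariant under
    \<open>M\<close>, so this equation is the minimality of \<open>M\<close>.\<close>
  then have "Z = T" using H(2) Z unfolding minimal_def by blast
  then show ?thesis unfolding minimal_def Z_def \<F>_def using subdendrite_simps(4) by blast
qed

text \<open>Otherwise any two translates of \<open>Y\<close> meet, since moving one of them back to
  \<open>Y\<close> turns the other into a translate again. By the Helly property all translates then
  have a subdendrite in common; it is invariant, hence \<open>T\<close>, and yet contained in
  \<open>Y\<close>.\<close>

lemma minimal_displaces_subdendrite:
  assumes N: "subgroup N G" "minimal N" and Y: "subdendrite X Y" "Y \<noteq> T"
  shows "\<exists>m\<in>N. m ` Y \<inter> Y = {}"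
proof (rule ccontr)
  assume "\<not> (\<exists>m\<in>N. m ` Y \<inter> Y = {})"
  then have no: "m ` Y \<inter> Y \<noteq> {}" if "m \<in> N" for m using that by blast
  have NG: "m \<in> carrier G" if "m \<in> N" for m using that N subgroup.subset by blast
  have YT: "Y \<subseteq> T" using subdendrite_simps(4)[OF Y(1)] .
  define \<F> where "\<F> = (\<lambda>m. m ` Y) ` N"
  have oneN: "\<one>\<^bsub>G\<^esub> \<in> N" using subgroup.one_closed[OF N(1)] .
  have "\<one>\<^bsub>G\<^esub> ` Y = Y" using one_apply YT by force
  then have YF: "Y \<in> \<F>" using oneN unfolding \<F>_def by force
  have Z: "subdendrite X (\<Inter>\<F>)"
  proof (rule subdendrites_Inter)
    show "\<F> \<noteq> {}" using YF by blast
    show "subdendrite X A" if "A \<in> \<F>" for A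
      using that subdendrite_image[OF NG Y(1)] by (auto simp: \<F>_def)
    show "A \<inter> B \<noteq> {}" if AB: "A \<in> \<F>" "B \<in> \<F>" for A B
    proof -
      obtain m n where mn: "m \<in> N" "n \<in> N" "A = m ` Y" "B = n ` Y" using AB by (auto simp: \<F>_def)
      define k where "k = inv\<^bsub>G\<^esub> m \<otimes>\<^bsub>G\<^esub> n"
      have k: "k \<in> N" using mn N(1) unfolding k_def by (simp add: subgroup.m_closed subgroup.m_inv_closed)
      obtain y where y: "y \<in> Y" "k y \<in> Y" using no[OF k] by blast
      then have "m (k y) = n y"
        using mn NG YT inv_apply(2) apply_T by (simp add: k_def mult_apply subset_iff)
      then show ?thesis using y mn by (metis disjoint_iff imageI)
    qed
  qed
  have "n ` \<Inter>\<F> \<subseteq> \<Inter>\<F>" if n: "n \<in> N" for n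
  proof -
    have "n ` \<Inter>\<F> \<subseteq> m ` Y" if m: "m \<in> N" for m
    proof -
      define k where "k = inv\<^bsub>G\<^esub> n \<otimes>\<^bsub>G\<^esub> m"
      have k: "k \<in> N" using m n N(1) unfolding k_def by (simp add: subgroup.m_closed subgroup.m_inv_closed)
      then have "n ` \<Inter>\<F> \<subseteq> n ` k ` Y" by (auto simp: \<F>_def)
      also have "\<dots> = m ` Y"
        unfolding image_image using m n NG YT inv_apply(2) apply_T
        by (intro image_cong) (auto simp: k_def mult_apply subset_iff)
      finally show ?thesis .
    qed
    then show ?thesis by (auto simp: \<F>_def)
  qed
  then have "\<forall>n\<in>N. n ` \<Inter>\<F> = \<Inter>\<F>" using invariantI[OF N(1) subdendrite_simps(4)[OF Z]] by blast
  then have "\<Inter>\<F> = T" using N(2) Z unfolding minimal_def by blast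
  then show False using YF YT Y(2) by blast
qed


subsection \<open>Infinite products of homeomorphisms with disjoint supports\<close>

text \<open>Meant for disjoint \<open>C k\<close>, where \<open>THE\<close> picks the only possible
  index.\<close>

definition infinite_prod :: "(nat \<Rightarrow> 'a set) \<Rightarrow> (nat \<Rightarrow> 'a \<Rightarrow> 'a) \<Rightarrow> 'a \<Rightarrow> 'a" where
  "infinite_prod C \<phi> x = (if \<exists>k. x \<in> C k then \<phi> (THE k. x \<in> C k) x else x)"

lemma infinite_prod_in:
  assumes "disjoint_family C" "x \<in> C k"
  shows "infinite_prod C \<phi> x = \<phi> k x"
proof -
  have "(THE k. x \<in> C k) = k" using assms by (intro the_equality) (auto simp: disjoint_family_on_def)
  then show ?thesis using assms(2) by (auto simp: infinite_prod_def)
qed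

lemma infinite_prod_notin: "(\<And>k. x \<notin> C k) \<Longrightarrow> infinite_prod C \<phi> x = x"
  by (simp add: infinite_prod_def)

text \<open>A point of \<open>C\<close> sent outside \<open>C\<close> would have the same image as
  its own image, against injectivity.\<close>

lemma support_invariant:
  assumes "\<phi> \<in> carrier G" "\<And>x. \<lbrakk>x \<in> T; x \<notin> C\<rbrakk> \<Longrightarrow> \<phi> x = x"
    "C \<subseteq> T" "x \<in> C"
  shows "\<phi> x \<in> C"
proof (rule ccontr)
  assume "\<phi> x \<notin> C"
  moreover have "x \<in> T" "\<phi> x \<in> T" using assms apply_T by auto
  ultimately have "\<phi> (\<phi> x) = \<phi> x" using assms(2) by blast
  then have "\<phi> x = x" using apply_eq_iff[OF assms(1)] \<open>x \<in> T\<close> \<open>\<phi> x \<in> T\<close> by blast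
  then show False using assms(4) \<open>\<phi> x \<notin> C\<close> by simp
qed

text \<open>On the open set \<open>C k\<close> the map is \<open>\<phi> k\<close>. Near a point
  \<open>y\<close> in no \<open>C k\<close>, all but finitely many of the sets that come close lie
  in \<open>V\<close>, and each is mapped into itself; the finitely many exceptions are handled by
  continuity of their \<open>\<phi> k\<close>, which fix \<open>y\<close>.\<close>

lemma infinite_prod_continuous:
  fixes C :: "nat \<Rightarrow> 'a set"
  assumes disj: "disjoint_family C"
    and C: "\<And>k. openin X (C k)" "\<And>k. connectedin X (C k)"
    and \<phi>: "\<And>k. \<phi> k \<in> carrier G" "\<And>k x. \<lbrakk>x \<in> T; x \<notin> C k\<rbrakk>
      \<Longrightarrow> \<phi> k x = x"
  shows "continuous_map X X (infinite_prod C \<phi>)"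
proof -
  let ?F = "infinite_prod C \<phi>"
  have CT: "C k \<subseteq> T" for k using C(1) openin_subset by blast
  have FC: "?F x \<in> C k" if "x \<in> C k" for x k
    using infinite_prod_in[OF disj that] support_invariant[OF \<phi> CT that] by simp
  have FT: "?F x \<in> T" if "x \<in> T" for x
    using FC infinite_prod_notin[of x C] CT that by (metis subsetD)
  have "openin X {x \<in> T. ?F x \<in> V}" if V: "openin X V" for V
    unfolding openin_subopen[of X "{x \<in> T. ?F x \<in> V}"]
  proof
    fix y assume y: "y \<in> {x \<in> T. ?F x \<in> V}"
    have pre: "openin X {x \<in> T. \<phi> k x \<in> V}" for k
      using openin_continuous_map_preimage[OF cont[OF \<phi>(1)] V] .
    show "\<exists>W. openin X W \<and> y \<in> W \<and> W \<subseteq> {x \<in> T. ?F x \<in> V}"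
    proof (cases "\<exists>k. y \<in> C k")
      case True
      then obtain k where k: "y \<in> C k" by blast
      have eq: "?F x = \<phi> k x" if "x \<in> C k" for x using infinite_prod_in[OF disj that] .
      then have "y \<in> C k \<inter> {x \<in> T. \<phi> k x \<in> V}" using y k by simp
      moreover have "C k \<inter> {x \<in> T. \<phi> k x \<in> V} \<subseteq> {x \<in> T. ?F x \<in> V}" using eq by auto
      ultimately show ?thesis using openin_Int[OF C(1) pre] by blast
    next
      case False
      then have "?F y = y" using infinite_prod_notin by metis
      then have yV: "y \<in> V" using y by simp
      obtain W J where W: "openin X W" "y \<in> W" "finite J"
        "\<And>k. \<lbrakk>k \<notin> J; C k \<inter> W \<noteq> {}\<rbrakk> \<Longrightarrow> C k \<subseteq> V"
        using disjoint_connected_null[of C V y] C(2) V yV disj by (metis UNIV_I disjoint_family_on_def)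
      \<comment> \<open>\<open>V\<close> takes care of points in no \<open>C k\<close>. The factor
        \<open>T\<close> is there for empty \<open>J\<close>, where the intersection is
        \<open>UNIV\<close>.\<close>
      define W' where "W' = W \<inter> V \<inter> (T \<inter> (\<Inter>k\<in>J. {x \<in> T. \<phi> k x \<in> V}))"
      have "openin X (T \<inter> (\<Inter>k\<in>J. {x \<in> T. \<phi> k x \<in> V}))"
      proof (cases "J = {}")
        case False
        then have "openin X (\<Inter>k\<in>J. {x \<in> T. \<phi> k x \<in> V})" using pre W(3) by (intro openin_Inter) auto
        then show ?thesis by (rule openin_Int[OF openin_topspace])
      qed simp
      then have "openin X W'" unfolding W'_def by (rule openin_Int[OF openin_Int[OF W(1) V]])
      moreover have "y \<in> W'"
        using W(2) yV y \<phi>(2)[of y] False by (auto simp: W'_def)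
      moreover have "?F z \<in> V" if z: "z \<in> W'" for z
      proof (cases "\<exists>k. z \<in> C k")
        case True
        then obtain k where k: "z \<in> C k" by blast
        show ?thesis
        proof (cases "k \<in> J")
          case True
          then have "\<phi> k z \<in> V" using z by (auto simp: W'_def)
          then show ?thesis using infinite_prod_in[OF disj k] by simp
        next
          case False
          moreover have "C k \<inter> W \<noteq> {}" using z k by (auto simp: W'_def)
          ultimately show ?thesis using W(4) FC[OF k] by blast
        qed
      next
        case False
        then have "?F z = z" using infinite_prod_notin by metis
        then show ?thesis using z by (simp add: W'_def)
      qed
      ultimately show ?thesis by (intro exI[of _ W']) (auto simp: W'_def)
    qed
  qed
  then show ?thesis unfolding continuous_map_def using FT by blast
qed

text \<open>The inverse is the product of the inverses, because each factor maps its own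
  \<open>C k\<close> into itself.\<close>

lemma infinite_prod_carrier:
  fixes C :: "nat \<Rightarrow> 'a set"
  assumes disj: "disjoint_family C"
    and C: "\<And>k. openin X (C k)" "\<And>k. connectedin X (C k)"
    and \<phi>: "\<And>k. \<phi> k \<in> carrier G" "\<And>k x. \<lbrakk>x \<in> T; x \<notin> C k\<rbrakk>
      \<Longrightarrow> \<phi> k x = x"
  shows "restrict (infinite_prod C \<phi>) T \<in> carrier G"
proof -
  define \<psi> where "\<psi> k = inv\<^bsub>G\<^esub> \<phi> k" for k
  have \<psi>: "\<psi> k \<in> carrier G" for k using \<phi>(1) by (simp add: \<psi>_def)
  have inv: "\<psi> k (\<phi> k x) = x" "\<phi> k (\<psi> k x) = x" if "x \<in> T" for k x
    using inv_apply[OF \<phi>(1) that] by (simp_all add: \<psi>_def)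
  have \<psi>2: "\<psi> k x = x" if "x \<in> T" "x \<notin> C k" for k x
    using inv(1)[OF that(1), of k] \<phi>(2)[OF that] by simp
  have CT: "C k \<subseteq> T" for k using C(1) openin_subset by blast
  have comp: "infinite_prod C \<alpha> (infinite_prod C \<beta> x) = x"
    if "\<And>k. \<beta> k \<in> carrier G" "\<And>k x. \<lbrakk>x \<in> T; x \<notin> C k\<rbrakk>
      \<Longrightarrow> \<beta> k x = x"
      "\<And>k x. x \<in> T
        \<Longrightarrow> \<alpha> k (\<beta> k x) = x" for \<alpha> \<beta> :: "nat \<Rightarrow> 'a \<Rightarrow> 'a" and x
  proof (cases "\<exists>k. x \<in> C k")
    case True
    then obtain k where k: "x \<in> C k" by blast
    have "\<beta> k x \<in> C k" using support_invariant[OF that(1,2) CT k] by blast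
    then have "infinite_prod C \<alpha> (infinite_prod C \<beta> x) = \<alpha> k (\<beta> k x)"
      using infinite_prod_in[OF disj k, of \<beta>] infinite_prod_in[OF disj, of "\<beta> k x" k \<alpha>] by simp
    moreover have "x \<in> T" using k CT by auto
    ultimately show ?thesis using that(3) by simp
  next
    case False
    then show ?thesis by (simp add: infinite_prod_notin)
  qed
  show ?thesis
  proof (rule carrier_GI)
    show "continuous_map X X (infinite_prod C \<phi>)" by (rule infinite_prod_continuous[OF disj C \<phi>])
    show "continuous_map X X (infinite_prod C \<psi>)" by (rule infinite_prod_continuous[OF disj C \<psi> \<psi>2])
    show "infinite_prod C \<psi> (infinite_prod C \<phi> x) = x" for x by (rule comp[OF \<phi> inv(1)])
    show "infinite_prod C \<phi> (infinite_prod C \<psi> x) = x" for x by (rule comp[OF \<psi> \<psi>2 inv(2)])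
  qed
qed

text \<open>If the translates of \<open>C\<close> under \<open>s\<close> are disjoint, then every \<open>f\<close> supported in \<open>C\<close> is the commutator
  of \<open>s\<close> with the infinite product of the conjugates of \<open>f\<close>
    by the powers of \<open>s\<close>.\<close>

lemma commutator_of_translation:
  assumes s: "s \<in> carrier G" and C: "openin X C" "connectedin X C"
    and wander: "\<And>k::nat. k > 0 \<Longrightarrow> (s [^]\<^bsub>G\<^esub> k) ` C \<inter> C = {}"
    and f: "f \<in> carrier G" "\<And>x. \<lbrakk>x \<in> T; x \<notin> C\<rbrakk> \<Longrightarrow> f x = x"
  obtains F where "F \<in> carrier G"
    "f = F \<otimes>\<^bsub>G\<^esub> s \<otimes>\<^bsub>G\<^esub> inv\<^bsub>G\<^esub> F \<otimes>\<^bsub>G\<^esub> inv\<^bsub>G\<^esub> s"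
    "\<And>x. \<lbrakk>x \<in> T; \<And>k::nat. x \<notin> (s [^]\<^bsub>G\<^esub> k) ` C\<rbrakk> \<Longrightarrow> F x = x"
proof -
  define \<sigma> where "\<sigma> k = s [^]\<^bsub>G\<^esub> k" for k :: nat
  have \<sigma>: "\<sigma> k \<in> carrier G" for k using s by (simp add: \<sigma>_def)
  have CT: "C \<subseteq> T" using C(1) openin_subset by blast
  define D where "D k = \<sigma> k ` C" for k
  have D0: "D 0 = C" using CT one_apply by (force simp: D_def \<sigma>_def)
  have DT: "D k \<subseteq> T" for k unfolding D_def using image_sub[OF \<sigma> CT] .
  have \<sigma>_Suc: "\<sigma> (Suc k) x = s (\<sigma> k x)" if "x \<in> T" for k x
    using G.nat_pow_Suc2[OF s, of k] mult_apply[OF s \<sigma> that, of k] by (simp only: \<sigma>_def)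
  have sD: "s ` D k = D (Suc k)" for k
    unfolding D_def image_image using CT \<sigma>_Suc by (intro image_cong) auto
  \<comment> \<open>\<open>wander\<close> only separates \<open>C\<close> from its translates;
    \<open>D j\<close> and \<open>D k\<close> are the images under \<open>\<sigma> j\<close> of
    \<open>C\<close> and \<open>D (k - j)\<close>.\<close>
  have disj_less: "D j \<inter> D k = {}" if "j < k" for j k
  proof -
    have "\<sigma> k = \<sigma> j \<otimes>\<^bsub>G\<^esub> \<sigma> (k - j)"
      using that s by (simp add: \<sigma>_def G.nat_pow_mult)
    then have "D k = \<sigma> j ` D (k - j)"
      unfolding D_def using image_mult[OF \<sigma> \<sigma> CT] by metis
    moreover have "D (k - j) \<inter> C = {}" using wander[of "k - j"] that by (simp add: D_def \<sigma>_def)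
    ultimately show ?thesis
      using inj_on_image_Int[OF inj_G[OF \<sigma>], of C "D (k - j)" j] CT DT[of "k - j"]
      by (simp add: D_def[of j] Int_commute)
  qed
  have disj: "D j \<inter> D k = {}" if "j \<noteq> k" for j k
    using disj_less[of j k] disj_less[of k j] that by (metis Int_commute linorder_neqE_nat)
  then have dfam: "disjoint_family D" by (auto simp: disjoint_family_on_def)
  have D: "openin X (D k)" "connectedin X (D k)" for k
    unfolding D_def using openin_image[OF \<sigma> C(1)] connectedin_image[OF \<sigma> C(2)] by auto
  define \<phi> where "\<phi> k = \<sigma> k \<otimes>\<^bsub>G\<^esub> f \<otimes>\<^bsub>G\<^esub> inv\<^bsub>G\<^esub> \<sigma> k" for k
  have \<phi>: "\<phi> k \<in> carrier G" for k using \<sigma> f(1) by (simp add: \<phi>_def)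
  have \<phi>_\<sigma>: "\<phi> k (\<sigma> k x) = \<sigma> k (f x)" if "x \<in> T" for k x
    using that \<sigma> f(1) apply_T inv_apply(1)[OF \<sigma>] by (simp add: \<phi>_def mult_apply)
  have \<phi>_id: "\<phi> k x = x" if x: "x \<in> T" "x \<notin> D k" for k x
  proof -
    define z where "z = (inv\<^bsub>G\<^esub> \<sigma> k) x"
    have z: "z \<in> T" "\<sigma> k z = x"
      using apply_T[of "inv\<^bsub>G\<^esub> \<sigma> k"] inv_apply(2)[OF \<sigma>] x(1) \<sigma> by (auto simp: z_def)
    then have "z \<notin> C" using x(2) by (auto simp: D_def)
    then show ?thesis using \<phi>_\<sigma>[OF z(1), of k] z f(2) by simp
  qed
  define F where "F = restrict (infinite_prod D \<phi>) T"
  have F: "F \<in> carrier G" unfolding F_def by (rule infinite_prod_carrier[OF dfam D \<phi> \<phi>_id])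
  have F_in: "F x = \<phi> k x" if "x \<in> D k" for x k
    using infinite_prod_in[OF dfam that] that DT unfolding F_def by auto
  have F_out: "F x = x" if "x \<in> T" "\<And>k. x \<notin> D k" for x
    using that infinite_prod_notin[of x D] by (simp add: F_def)
  \<comment> \<open>The commutator identity without inverses. From \<open>D k\<close> the map
    \<open>s\<close> leads to \<open>D (Suc k)\<close>, where \<open>F\<close> is conjugated along
    with \<open>s\<close> and \<open>f\<close> is trivial. A point outside all \<open>D k\<close>
    can only enter \<open>D 0 = C\<close>, where \<open>F\<close> is \<open>f\<close>.\<close>
  have key: "F (s x) = f (s (F x))" if x: "x \<in> T" for x
  proof (cases "\<exists>k. x \<in> D k")
    case True
    then obtain k c where k: "x \<in> D k" and c: "c \<in> C" "x = \<sigma> k c" by (auto simp: D_def)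
    have cT: "c \<in> T" using c CT by blast
    have "s x = \<sigma> (Suc k) c" using \<sigma>_Suc[OF cT] c(2) by simp
    moreover have "s x \<in> D (Suc k)" using sD k by blast
    ultimately have "F (s x) = \<sigma> (Suc k) (f c)" using F_in \<phi>_\<sigma>[OF cT] by metis
    moreover have "F x = \<sigma> k (f c)" using F_in[OF k] \<phi>_\<sigma>[OF cT] c(2) by simp
    ultimately have 1: "F (s x) = s (F x)" using \<sigma>_Suc[of "f c"] apply_T[OF f(1) cT] by simp
    have "f c \<in> C" by (rule support_invariant[OF f CT c(1)])
    then have "F x \<in> D k" using \<open>F x = \<sigma> k (f c)\<close> by (simp add: D_def)
    then have "s (F x) \<in> D (Suc k)" using sD by blast
    then have "s (F x) \<notin> C" "s (F x) \<in> T" using disj[of "Suc k" 0] D0 DT by auto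
    then show ?thesis using 1 f(2) by simp
  next
    case False
    then have Fx: "F x = x" using F_out x by blast
    have sxT: "s x \<in> T" using apply_T s x by blast
    have "s x \<notin> D (Suc k)" for k
    proof
      assume "s x \<in> D (Suc k)"
      then obtain y where "y \<in> D k" "s x = s y" using sD by (metis imageE)
      then show False using apply_eq_iff[OF s x] DT False by blast
    qed
    then have nD: "s x \<notin> D k" if "k \<noteq> 0" for k using that by (metis not0_implies_Suc)
    show ?thesis
    proof (cases "s x \<in> C")
      case True
      then have "F (s x) = \<phi> 0 (s x)" using F_in[of "s x" 0] D0 by simp
      also have "\<dots> = f (s x)" using \<phi>_\<sigma>[OF sxT, of 0] one_apply sxT apply_T[OF f(1)]
        by (simp add: \<sigma>_def)
      finally show ?thesis using Fx by simp
    next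
      case False
      then have "\<And>k. s x \<notin> D k" using nD D0 by metis
      then show ?thesis using F_out[OF sxT] f(2)[OF sxT False] Fx by simp
    qed
  qed
  have "F \<otimes>\<^bsub>G\<^esub> s = f \<otimes>\<^bsub>G\<^esub> s \<otimes>\<^bsub>G\<^esub> F"
    using key F s f(1) by (intro G_eqI) (auto simp: mult_apply apply_T)
  then have "F \<otimes>\<^bsub>G\<^esub> s \<otimes>\<^bsub>G\<^esub> inv\<^bsub>G\<^esub> F \<otimes>\<^bsub>G\<^esub> inv\<^bsub>G\<^esub> s = f \<otimes>\<^bsub>G\<^esub> s \<otimes>\<^bsub>G\<^esub> F \<otimes>\<^bsub>G\<^esub> inv\<^bsub>G\<^esub> F \<otimes>\<^bsub>G\<^esub> inv\<^bsub>G\<^esub> s"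
    by simp
  also have "\<dots> = f" using F s f(1) by (simp add: G.m_assoc)
  finally have "f = F \<otimes>\<^bsub>G\<^esub> s \<otimes>\<^bsub>G\<^esub> inv\<^bsub>G\<^esub> F \<otimes>\<^bsub>G\<^esub> inv\<^bsub>G\<^esub> s" ..
  then show thesis using that[OF F] F_out by (auto simp: D_def \<sigma>_def)
qed

lemma rigid_in_normalized_subgroup:
  assumes N: "subgroup N G" "N \<subseteq> K" "minimal N"
    and norm: "\<And>k n. \<lbrakk>k \<in> K; n \<in> N\<rbrakk>
      \<Longrightarrow> k \<otimes>\<^bsub>G\<^esub> n \<otimes>\<^bsub>G\<^esub> inv\<^bsub>G\<^esub> k \<in> N"
    and h: "rigid h p C"
  shows "h \<in> N"
proof -
  have h': "h \<in> carrier G" "p \<in> branch_points X" "C \<in> comps p" "\<And>x. x \<in> C \<Longrightarrow> h x = x"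
    using h by (auto simp: rigid_def)
  obtain D E where pT: "p \<in> T" and DE: "D \<in> comps p" "E \<in> comps p" "C \<noteq> D" "C \<noteq> E" "D \<noteq> E"
    by (rule branch_pointE[OF h'(2,3)])
  have NG: "n \<in> carrier G" if "n \<in> N" for n using that N(1) subgroup.subset by blast
  have "\<exists>n\<in>N. n ` (T - B) \<subseteq> B" if B: "B \<in> comps p" for B
  proof -
    obtain n where n: "n \<in> N" "n ` (T - B) \<inter> (T - B) = {}"
      using minimal_displaces_subdendrite[OF N(1,3) subdendrite_complement_comps[OF pT B]] by blast
    then have "n ` (T - B) \<subseteq> B" using image_sub[OF NG[OF n(1)], of "T - B"] by blast
    then show ?thesis using n(1) by blast
  qed
  then obtain a b c where abc: "a \<in> N" "b \<in> N" "c \<in> N"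
      "a ` (T - C) \<subseteq> C" "b ` (T - D) \<subseteq> D" "c ` (T - E) \<subseteq> E"
    using h'(3) DE(1,2) by metis
  have abcG: "a \<in> carrier G" "b \<in> carrier G" "c \<in> carrier G" using abc NG by auto
  have disj: "C \<inter> D = {}" "C \<inter> E = {}" "D \<inter> E = {}" using comps_disjoint h'(3) DE by blast+
  have sub: "C \<subseteq> T" "D \<subseteq> T" "E \<subseteq> T" using comps_subset[OF pT] h'(3) DE by blast+
  \<comment> \<open>\<open>b\<close> moves everything off \<open>D\<close> into \<open>D\<close>,
    which is off \<open>E\<close>; then \<open>c\<close> moves it into \<open>E\<close>. As
    \<open>E\<close> is off \<open>D\<close>, every positive power of \<open>s\<close> sends
    \<open>C\<close> into \<open>E\<close>.\<close>
  define s where "s = c \<otimes>\<^bsub>G\<^esub> b"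
  have sN: "s \<in> N" unfolding s_def using subgroup.m_closed[OF N(1)] abc by blast
  have sG: "s \<in> carrier G" using NG sN .
  have s: "s x \<in> E" if "x \<in> T - D" for x
  proof -
    have "b x \<in> D" using abc(5) that by blast
    then have "b x \<in> T - E" using disj(3) sub by blast
    then have "c (b x) \<in> E" using abc(6) by blast
    then show ?thesis using that abcG by (simp add: s_def mult_apply)
  qed
  have pow: "(s [^]\<^bsub>G\<^esub> Suc k) ` C \<subseteq> E" for k
  proof (induction k)
    case 0
    have "s x \<in> E" if "x \<in> C" for x using s that disj sub by blast
    then show ?case using sG by auto
  next
    case (Suc k)
    have "(s [^]\<^bsub>G\<^esub> Suc (Suc k)) x \<in> E" if x: "x \<in> C" for x
    proof -
      have xT: "x \<in> T" using x sub by blast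
      have "(s [^]\<^bsub>G\<^esub> Suc k) x \<in> T - D" using Suc x disj sub by blast
      moreover have "(s [^]\<^bsub>G\<^esub> Suc (Suc k)) x = s ((s [^]\<^bsub>G\<^esub> Suc k) x)"
        unfolding G.nat_pow_Suc2[OF sG, of "Suc k"] by (rule mult_apply[OF sG G.nat_pow_closed[OF sG] xT])
      ultimately show ?thesis using s by metis
    qed
    then show ?case by blast
  qed
  have wander: "(s [^]\<^bsub>G\<^esub> k) ` C \<inter> C = {}" if "k > 0" for k :: nat
    using pow[of "k - 1"] that disj(2) by auto
  \<comment> \<open>\<open>a\<close> sends all points off \<open>C\<close> into \<open>C\<close>,
    where \<open>h\<close> is trivial; so \<open>f\<close> is trivial off \<open>C\<close>.\<close>
  define f where "f = inv\<^bsub>G\<^esub> a \<otimes>\<^bsub>G\<^esub> h \<otimes>\<^bsub>G\<^esub> a"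
  have fG: "f \<in> carrier G" using abcG h'(1) by (simp add: f_def)
  have f_id: "f x = x" if x: "x \<in> T" "x \<notin> C" for x
  proof -
    have "a x \<in> C" using abc(4) x by blast
    then have "h (a x) = a x" using h'(4) by blast
    then show ?thesis
      using x abcG h'(1) inv_apply(1)[OF abcG(1)] apply_T by (simp add: f_def mult_apply)
  qed
  obtain F where F: "F \<in> carrier G"
    "f = F \<otimes>\<^bsub>G\<^esub> s \<otimes>\<^bsub>G\<^esub> inv\<^bsub>G\<^esub> F \<otimes>\<^bsub>G\<^esub> inv\<^bsub>G\<^esub> s"
    "\<And>x. \<lbrakk>x \<in> T; \<And>k::nat. x \<notin> (s [^]\<^bsub>G\<^esub> k) ` C\<rbrakk> \<Longrightarrow> F x = x"
    using commutator_of_translation[OF sG comps_open[OF pT h'(3)] comps_connected[OF pT h'(3)] wander fG f_id]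
    by metis
  \<comment> \<open>\<open>p\<close> is neither in \<open>C\<close> nor in \<open>E\<close>, which
    contains the further translates. This puts \<open>F\<close> into \<open>K\<close>, so that
    conjugation by \<open>F\<close> preserves \<open>N\<close>.\<close>
  have "F p = p"
  proof (rule F(3)[OF pT])
    fix k :: nat
    show "p \<notin> (s [^]\<^bsub>G\<^esub> k) ` C"
    proof (cases k)
      case 0
      have "p \<notin> C" using comps_notin[OF pT h'(3)] .
      then show ?thesis using 0 sub one_apply by auto
    next
      case (Suc j)
      then show ?thesis using pow[of j] comps_notin[OF pT DE(2)] by blast
    qed
  qed
  then have "F \<in> K" using stabilizer_in_K[OF F(1) h'(2)] by blast
  then have "F \<otimes>\<^bsub>G\<^esub> s \<otimes>\<^bsub>G\<^esub> inv\<^bsub>G\<^esub> F \<in> N" using norm sN by blast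
  then have fN: "f \<in> N" 
    unfolding F(2) using sN N(1) by (simp add: subgroup.m_closed subgroup.m_inv_closed)
  have "h = a \<otimes>\<^bsub>G\<^esub> f \<otimes>\<^bsub>G\<^esub> inv\<^bsub>G\<^esub> a"
  proof -
    have "a \<otimes>\<^bsub>G\<^esub> f = h \<otimes>\<^bsub>G\<^esub> a"
      unfolding f_def using abcG(1) h'(1) by (simp flip: G.m_assoc)
    then show ?thesis using abcG(1) h'(1) by (simp add: G.m_assoc)
  qed
  then show ?thesis using fN abc(1) N(1) by (simp add: subgroup.m_closed subgroup.m_inv_closed)
qed

text \<open>\<open>normalized_subgroup_minimal\<close> is used twice, for \<open>K\<close> in the
  full group and for \<open>N\<close> in \<open>K\<close>; the same \<open>n\<close> and
  \<open>q\<close> rule out fixed points both times.\<close>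

theorem normal_subgroup_moving_branch_point:
  assumes min: "dendro_minimal X" and N: "subgroup N G" "N \<subseteq> K"
    and norm: "\<And>k n. \<lbrakk>k \<in> K; n \<in> N\<rbrakk>
      \<Longrightarrow> k \<otimes>\<^bsub>G\<^esub> n \<otimes>\<^bsub>G\<^esub> inv\<^bsub>G\<^esub> k \<in> N"
    and n: "n \<in> N" "q \<in> branch_points X" "n q \<noteq> q"
  shows "N = K"
proof -
  have "minimal K"
  proof (rule normalized_subgroup_minimal[where H = "carrier G" and q = q])
    show "minimal (carrier G)" using min minimal_G_iff by simp
    show "n \<in> K" using n(1) N(2) by blast
  qed (use subgroup_K G.subgroup_self n K_conj in blast)+
  then have "minimal N"
    using normalized_subgroup_minimal[OF N(1) subgroup_K _ _ n] norm by blast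
  then have "K \<subseteq> N"
    using rigid_in_normalized_subgroup[OF N] norm K_subset_if_rigid[OF N(1)] by blast
  then show ?thesis using N(2) by blast
qed


subsection \<open>Homeomorphisms fixing all branch points\<close>

text \<open>A branch point \<open>c\<close> is fixed by \<open>n\<close>, which thus permutes the
  components at \<open>c\<close>. By minimality the component of \<open>y\<close> contains a branch
  point, itself fixed, so it is mapped to itself and \<open>c\<close> does not separate
  \<open>y\<close> from \<open>n y\<close>.\<close>

lemma no_branch_point_between_image:
  assumes min: "dendro_minimal X" and n: "n \<in> carrier G" "\<And>q. q \<in> branch_points X \<Longrightarrow> n q = q"
    and y: "y \<in> T" and c: "c \<in> interval y (n y)" "c \<noteq> y" "c \<noteq> n y"
  shows "c \<notin> branch_points X"
proof
  assume br: "c \<in> branch_points X"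
  have cT: "c \<in> T" using br branch_T by blast
  obtain A where A: "A \<in> comps c" "y \<in> A" using ex_comps y c(2) by metis
  have nA: "n ` A \<in> comps c" using comps_image[OF n(1) cT A(1)] n(2)[OF br] by simp
  have "branch_points X \<inter> A \<noteq> {}"
  proof (rule invariant_set_meets_comps[OF G.subgroup_self _ _ _ _ cT A(1)])
    show "minimal (carrier G)" using min minimal_G_iff by simp
    show "h ` branch_points X \<subseteq> branch_points X" if "h \<in> carrier G" for h
      using branch_image[OF that] by blast
  qed (use br branch_T in auto)
  then obtain q where q: "q \<in> branch_points X" "q \<in> A" by blast
  then have "q \<in> n ` A" using n(2)[OF q(1)] by (metis imageI)
  then have "n ` A = A" using comps_disjoint[OF nA A(1)] q(2) by blast
  then have "n y \<in> A" using A(2) by blast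
  then show False using interval_separates[OF A(1) c(1) A(2) cT] by blast
qed

lemma free_arc_if_fixes_branch_points:
  assumes min: "dendro_minimal X" and n: "n \<in> carrier G" "\<And>q. q \<in> branch_points X \<Longrightarrow> n q = q"
    and "n \<noteq> \<one>\<^bsub>G\<^esub>"
  shows "\<exists>A. free_arc X A"
proof -
  have "\<exists>y\<in>T. n y \<noteq> y"
    using G_eqI[OF n(1) G.one_closed] one_apply assms(4) by auto
  then obtain y where y: "y \<in> T" "n y \<noteq> y" by blast
  have "free_arc X (interval y (n y))"
    using no_branch_point_between_image[OF min n y(1)] y apply_T[OF n(1) y(1)]
    by (intro free_arc_interval) auto
  then show ?thesis by blast
qed

lemma free_arc_image:
  assumes g: "g \<in> carrier G" and A: "free_arc X A" shows "free_arc X (g ` A)"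
proof -
  obtain h where h: "embedding_map (top_of_set {0..1::real}) X h" "A = h ` {0..1}" "openin X (A - {h 0, h 1})"
    using A unfolding free_arc_def by blast
  have emb: "embedding_map (top_of_set {0..1::real}) X (g \<circ> h)"
  proof (rule embedding_map_compose[OF h(1)])
    show "embedding_map X X g" using homeo[OF g] image_T[OF g] by (simp add: embedding_map_def)
  qed
  have "continuous_map (top_of_set {0..1}) X h"
    using h(1) continuous_map_in_subtopology embedding_map_def homeomorphic_imp_continuous_map by blast
  then have AT: "A \<subseteq> T" unfolding h(2) by (auto simp: continuous_map_def)
  moreover have "h 0 \<in> A" "h 1 \<in> A" using h(2) by auto
  ultimately have "g ` (A - {h 0, h 1}) = g ` A - {g (h 0), g (h 1)}"
    using inj_on_image_set_diff[OF inj_G[OF g], of A "{h 0, h 1}"] by auto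
  then have "openin X (g ` A - {(g \<circ> h) 0, (g \<circ> h) 1})" using openin_image[OF g h(3)] by simp
  moreover have "g ` A = (g \<circ> h) ` {0..1}" using h(2) by (simp add: image_comp)
  ultimately show ?thesis using emb unfolding free_arc_def by blast
qed

lemma free_arc_subset: "free_arc X A \<Longrightarrow> A \<subseteq> T"
  by (metis free_arcE interval_subset_T)

lemma Free_image:
  assumes g: "g \<in> carrier G" and A: "A \<in> Free X" shows "g ` A \<in> Free X"
proof -
  have fA: "free_arc X A" and maxA: "\<And>B. \<lbrakk>free_arc X B; A \<subseteq> B\<rbrakk> \<Longrightarrow> B = A"
    using A unfolding Free_def by auto
  have "B = g ` A" if B: "free_arc X B" "g ` A \<subseteq> B" for B
  proof -
    have g': "inv\<^bsub>G\<^esub> g \<in> carrier G" using g by simp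
    have "(inv\<^bsub>G\<^esub> g) ` g ` A \<subseteq> (inv\<^bsub>G\<^esub> g) ` B" using B(2) by (rule image_mono)
    then have "A \<subseteq> (inv\<^bsub>G\<^esub> g) ` B" using image_inv(1)[OF g free_arc_subset[OF fA]] by simp
    then have "(inv\<^bsub>G\<^esub> g) ` B = A" using maxA free_arc_image[OF g' B(1)] by blast
    then show ?thesis using image_inv(2)[OF g free_arc_subset[OF B(1)]] by simp
  qed
  then show ?thesis using free_arc_image[OF g fA] unfolding Free_def by blast
qed

lemma connectedin_openD:
  assumes "connectedin X S" "openin X U" "openin X V" "S \<subseteq> U \<union> V" "U \<inter> V \<inter> S = {}"
  shows "U \<inter> S = {} \<or> V \<inter> S = {}"
  using assms unfolding connectedin by meson

text \<open>If a point of \<open>A\<close> left \<open>A\<close>, then \<open>A\<close> could be prolonged beyond an endpoint to that image without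
  meeting a branch point, against maximality.\<close>

lemma Free_invariant_if_fixes_branch_points:
  assumes min: "dendro_minimal X" and n: "n \<in> carrier G" "\<And>q. q \<in> branch_points X \<Longrightarrow> n q = q"
    and A: "A \<in> Free X"
  shows "n ` A = A"
proof -
  have fA: "free_arc X A" and maxA: "\<And>B. \<lbrakk>free_arc X B; A \<subseteq> B\<rbrakk> \<Longrightarrow> B = A"
    using A unfolding Free_def by auto
  obtain a b where ab: "a \<in> T" "b \<in> T" "a \<noteq> b" "A = interval a b" "openin X (A - {a, b})"
    "\<And>p. p \<in> A - {a, b} \<Longrightarrow> p \<notin> branch_points X"
    using free_arcE[OF fA] by metis
  have AT: "A \<subseteq> T" using free_arc_subset[OF fA] .
  have clA: "closedin X A" and conA: "connectedin X A"
    using interval_closed interval_connected ab by auto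
  have abA: "a \<in> A" "b \<in> A" using ab(4) endpoints_in_interval by auto
  have interior: "n p \<in> A" if p: "p \<in> A - {a, b}" for p
  proof (rule ccontr)
    assume np: "n p \<notin> A"
    have pT: "p \<in> T" using p AT by blast
    have npT: "n p \<in> T" using apply_T[OF n(1) pT] .
    define J where "J = interval p (n p)"
    have J: "connectedin X J" "p \<in> J" "n p \<in> J"
      unfolding J_def using interval_connected[OF pT npT] endpoints_in_interval by auto
    have nbJ: "x \<notin> branch_points X" if "x \<in> J" "x \<noteq> p" "x \<noteq> n p" for x
      using no_branch_point_between_image[OF min n pT, of x] that unfolding J_def by blast
    \<comment> \<open>The interior of \<open>A\<close> and the complement of \<open>A\<close> are
      open and disjoint, so the connected set \<open>J\<close> can leave \<open>A\<close> only
      through an endpoint.\<close>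
    have escape: "a \<in> J \<or> b \<in> J"
    proof (rule ccontr)
      assume "\<not> (a \<in> J \<or> b \<in> J)"
      then have "J \<subseteq> (A - {a, b}) \<union> (T - A)" using J(1) connectedin_subset_topspace by blast
      moreover have "openin X (T - A)" using clA by blast
      moreover have "(A - {a, b}) \<inter> (T - A) \<inter> J = {}" by blast
      ultimately show False
        using connectedin_openD[OF J(1) ab(5)] J(2,3) p np npT by blast
    qed
    \<comment> \<open>\<open>e\<close> is the endpoint on \<open>J\<close> and \<open>e'\<close> the
      other one. Then \<open>e\<close> lies between \<open>e'\<close> and \<open>n p\<close>, so
      \<open>interval e' (n p)\<close> is a prolongation of \<open>A\<close>.\<close>
    have False if e: "A = interval e' e" "{e', e} = {a, b}" "e \<in> J" for e e'
    proof -
      have e2: "(e' = a \<and> e = b) \<or> (e' = b \<and> e = a)" using e(2) by (auto simp: doubleton_eq_iff)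
      have eT: "e \<in> T" "e' \<in> T" and eA: "e \<in> A" "e' \<in> A" using e2 ab(1,2) abA by auto
      have ne: "e \<noteq> p" "e' \<noteq> p" "e \<noteq> n p" "e' \<noteq> n p" "e \<noteq> e'"
        using p e2 eA np ab(3) by auto
      obtain P where P: "P \<in> comps p" "e' \<in> P" using ex_comps[OF eT(2) ne(2)] by blast
      have "e \<notin> P" using interval_separates[OF P(1) _ P(2) pT, of e] p e(1) by blast
      have "interval e' p \<subseteq> insert p P"
        using insert_comps(2)[OF pT P(1)] P(2) by (intro interval_subset) auto
      then have eno: "e \<notin> interval e' p" using \<open>e \<notin> P\<close> ne(1) by blast
      obtain Q where Q: "Q \<in> comps e" "p \<in> Q" using ex_comps[OF pT] ne(1) by metis
      have "interval e' p \<subseteq> Q"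
        using comps_maximal[OF Q(1) interval_connected[OF eT(2) pT] eno] endpoints_in_interval(2)[of p e'] Q(2) by blast
      then have e'Q: "e' \<in> Q" using endpoints_in_interval(1)[of e' p] by blast
      have "n p \<notin> Q" using interval_separates[OF Q(1) _ Q(2) eT(1)] e(3) unfolding J_def by blast
      define F where "F = interval e' (n p)"
      have eF: "e \<in> F"
        unfolding F_def by (rule separated_in_interval[OF Q(1) e'Q npT \<open>n p \<notin> Q\<close> eT(1)])
      have F: "connectedin X F" "e' \<in> F" "n p \<in> F"
        unfolding F_def using interval_connected[OF eT(2) npT] endpoints_in_interval by auto
      have AF: "A \<subseteq> F" unfolding e(1) by (rule interval_subset[OF F(1,2) eF])
      have eJ: "interval e (n p) \<subseteq> J" by (rule interval_subset[OF J(1) e(3) J(3)])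
      have "F \<subseteq> A \<union> interval e (n p)"
        unfolding F_def using conA interval_connected[OF eT(1) npT] eA endpoints_in_interval
        by (intro interval_subset connectedin_Un) blast+
      then have FJ: "F \<subseteq> A \<union> J" using eJ by blast
      have "free_arc X F"
        unfolding F_def
      proof (rule free_arc_interval[OF eT(2) npT ne(4)])
        fix x assume x: "x \<in> interval e' (n p)" "x \<noteq> e'" "x \<noteq> n p"
        show "x \<notin> branch_points X"
        proof (cases "x \<in> A - {a, b}")
          case True
          then show ?thesis by (rule ab(6))
        next
          case False
          then have "x \<noteq> p" "x \<in> J" using p FJ x(1,2) e2 e(3) unfolding F_def by auto
          then show ?thesis using nbJ x(3) by blast
        qed
      qed
      then have "F = A" using maxA AF by blast
      then show False using F(3) np by blast
    qed
    from this[of a b] this[of b a] show False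
      using escape ab(4) interval_commute[of a b] by (auto simp: insert_commute)
  qed
  \<comment> \<open>Endpoints follow by continuity: the points that \<open>n\<close> sends outside
    \<open>A\<close> form an open set \<open>U\<close> meeting \<open>A\<close> in endpoints only,
    and these are not isolated in the connected set \<open>A\<close>.\<close>
  have "n x \<in> A" if x: "x \<in> A" for x
  proof (rule ccontr)
    assume nx: "n x \<notin> A"
    define U where "U = {z \<in> T. n z \<in> T - A}"
    have opU: "openin X U"
      unfolding U_def using clA by (intro openin_continuous_map_preimage[OF cont[OF n(1)]]) blast
    have xT: "x \<in> T" using x AT by blast
    have xU: "x \<in> U" using nx xT apply_T[OF n(1)] by (simp add: U_def)
    have UA: "U \<inter> (A - {a, b}) = {}" using interior by (auto simp: U_def)
    have xab: "x = a \<or> x = b" using interior x nx by blast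
    define y where "y = (if x = a then b else a)"
    have y: "y \<noteq> x" "y \<in> A" "y \<in> T" using xab ab(1-3) abA by (auto simp: y_def)
    have "U \<inter> A \<subseteq> {x, y}" using UA xab by (auto simp: y_def)
    then have "(U - {y}) \<inter> (T - {x}) \<inter> A = {}" by blast
    moreover have "A \<subseteq> (U - {y}) \<union> (T - {x})" using xU y(1) AT by blast
    moreover have "openin X (U - {y})" "openin X (T - {x})"
      using openin_delete opU openin_complement_point y(3) xT by auto
    moreover have "x \<in> (U - {y}) \<inter> A" "y \<in> (T - {x}) \<inter> A" using x xU y by auto
    ultimately show False using connectedin_openD[OF conA, of "U - {y}" "T - {x}"] by blast
  qed
  then have "n ` A \<subseteq> A" by blast
  \<comment> \<open>The image is again a maximal free arc, so its inclusion in \<open>A\<close>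
    already gives equality.\<close>
  moreover have "\<And>B. \<lbrakk>free_arc X B; n ` A \<subseteq> B\<rbrakk> \<Longrightarrow> B = n ` A"
    using Free_image[OF n(1) A] unfolding Free_def by blast
  ultimately show ?thesis using fA by blast
qed

subsection \<open>Simplicity\<close>

lemma G_Br_as_subgroup: "G_Br X = G\<lparr>carrier := K\<rparr>"
  by (simp add: G_Br_def)

lemma group_G_Br: "group (G_Br X)"
  by (subst G_Br_as_subgroup) (rule subgroup.subgroup_is_group[OF subgroup_K group_G])

lemma normal_G_Br:
  assumes "N \<lhd> G_Br X"
  shows "subgroup N G" "N \<subseteq> K" "\<And>k n. \<lbrakk>k \<in> K; n \<in> N\<rbrakk>
    \<Longrightarrow> k \<otimes>\<^bsub>G\<^esub> n \<otimes>\<^bsub>G\<^esub> inv\<^bsub>G\<^esub> k \<in> N"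
proof -
  have sub: "subgroup N (G\<lparr>carrier := K\<rparr>)"
    using assms normal_imp_subgroup by (metis G_Br_as_subgroup)
  show "subgroup N G" using G.incl_subgroup[OF subgroup_K sub] .
  show "N \<subseteq> K" using subgroup.subset[OF sub] by simp
  fix k n assume kn: "k \<in> K" "n \<in> N"
  have "k \<otimes>\<^bsub>G\<lparr>carrier := K\<rparr>\<^esub> n \<otimes>\<^bsub>G\<lparr>carrier := K\<rparr>\<^esub> inv\<^bsub>G\<lparr>carrier := K\<rparr>\<^esub> k \<in> N"
    using normal.inv_op_closed2[of N "G\<lparr>carrier := K\<rparr>" k n] assms kn by (simp flip: G_Br_as_subgroup)
  then show "k \<otimes>\<^bsub>G\<^esub> n \<otimes>\<^bsub>G\<^esub> inv\<^bsub>G\<^esub> k \<in> N"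
    using G.m_inv_consistent[OF subgroup_K kn(1)] by simp
qed

lemma simple_G_Br:
  assumes min: "dendro_minimal X" and noarc: "\<not> (\<exists>A. free_arc X A)"
  shows "is_simple (G_Br X)"
  unfolding is_simple_def
proof (intro conjI allI impI)
  show "group (G_Br X)" by (rule group_G_Br)
  fix N assume "N \<lhd> G_Br X"
  note N = normal_G_Br[OF this]
  have one: "\<one>\<^bsub>G_Br X\<^esub> = \<one>\<^bsub>G\<^esub>" by (simp add: G_Br_def)
  show "N = {\<one>\<^bsub>G_Br X\<^esub>} \<or> N = K"
  proof (cases "\<forall>n\<in>N. \<forall>q\<in>branch_points X. n q = q")
    case True
    have "n = \<one>\<^bsub>G\<^esub>" if "n \<in> N" for n
      using free_arc_if_fixes_branch_points[OF min, of n] noarc True that subgroup.subset[OF N(1)] by blast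
    then have "N = {\<one>\<^bsub>G\<^esub>}" using subgroup.one_closed[OF N(1)] by blast
    then show ?thesis using one by simp
  next
    case False
    then obtain n q where "n \<in> N" "q \<in> branch_points X" "n q \<noteq> q" by blast
    then show ?thesis using normal_subgroup_moving_branch_point[OF min N] by blast
  qed
qed

text \<open>The target is the full permutation group; \<open>Aut_Free X\<close> and
  \<open>G_Br_image X\<close> share its operations and differ from it only in the carrier.\<close>

lemma free_perm_hom: "free_perm X \<in> hom G (BijGroup (Free X))"
proof (rule homI)
  have Bij: "free_perm X g \<in> Bij (Free X)" if g: "g \<in> carrier G" for g
  proof -
    have g': "inv\<^bsub>G\<^esub> g \<in> carrier G" using g by simp
    have FT: "A \<subseteq> T" if "A \<in> Free X" for A using that free_arc_subset by (auto simp: Free_def)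
    have "bij_betw (\<lambda>A. g ` A) (Free X) (Free X)"
    proof (rule bij_betw_byWitness[where f' = "\<lambda>A. (inv\<^bsub>G\<^esub> g) ` A"])
      show "\<forall>A\<in>Free X. (inv\<^bsub>G\<^esub> g) ` g ` A = A"
        "\<forall>A\<in>Free X. g ` (inv\<^bsub>G\<^esub> g) ` A = A"
        using image_inv[OF g FT] by simp_all
      show "(\<lambda>A. g ` A) ` Free X \<subseteq> Free X"
        "(\<lambda>A. (inv\<^bsub>G\<^esub> g) ` A) ` Free X \<subseteq> Free X"
        using Free_image[OF g] Free_image[OF g'] by auto
    qed
    then have "bij_betw (free_perm X g) (Free X) (Free X)"
      by (rule bij_betw_cong[THEN iffD1, rotated]) (simp add: free_perm_def)
    then show ?thesis by (simp add: Bij_def free_perm_def)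
  qed
  then show "free_perm X g \<in> carrier (BijGroup (Free X))" if "g \<in> carrier G" for g
    using that by (simp add: BijGroup_def)
  fix g h assume gh: "g \<in> carrier G" "h \<in> carrier G"
  have "free_perm X (g \<otimes>\<^bsub>G\<^esub> h) = compose (Free X) (free_perm X g) (free_perm X h)"
  proof
    fix A
    show "free_perm X (g \<otimes>\<^bsub>G\<^esub> h) A = compose (Free X) (free_perm X g) (free_perm X h) A"
    proof (cases "A \<in> Free X")
      case True
      then have "A \<subseteq> T" using free_arc_subset by (auto simp: Free_def)
      then have "(g \<otimes>\<^bsub>G\<^esub> h) ` A = g ` h ` A" by (rule image_mult[OF gh])
      then show ?thesis using True Free_image[OF gh(2) True] by (simp add: free_perm_def compose_def)
    qed (simp add: free_perm_def compose_def)
  qed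
  then show "free_perm X (g \<otimes>\<^bsub>G\<^esub> h) = free_perm X g \<otimes>\<^bsub>BijGroup (Free X)\<^esub> free_perm X h"
    using Bij gh by (simp add: BijGroup_def)
qed

text \<open>A normal subgroup \<open>P\<close> of the image is pulled back to \<open>N\<close> in
  \<open>K\<close>. Either \<open>N\<close> fixes all branch points, hence every maximal free arc,
  and \<open>P\<close> is trivial; or \<open>N = K\<close> and \<open>P\<close> is the whole
  image.\<close>

lemma simple_G_Br_image:
  assumes min: "dendro_minimal X"
  shows "is_simple (G_Br_image X)"
proof -
  let ?B = "BijGroup (Free X)" let ?\<pi> = "free_perm X"
  interpret \<pi>: group_hom G ?B ?\<pi>
    by (intro group_hom.intro group_G group_BijGroup group_hom_axioms.intro free_perm_hom)
  have eq: "G_Br_image X = ?B\<lparr>carrier := ?\<pi> ` K\<rparr>"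
    by (simp add: G_Br_image_def Aut_Free_def)
  have sub: "subgroup (?\<pi> ` K) ?B" by (rule \<pi>.subgroup_img_is_subgroup[OF subgroup_K])
  have KG: "k \<in> carrier G" if "k \<in> K" for k using that subgroup.subset[OF subgroup_K] by blast
  show ?thesis
    unfolding is_simple_def
  proof (intro conjI allI impI)
    show grp: "group (G_Br_image X)"
      unfolding eq by (rule subgroup.subgroup_is_group[OF sub group_BijGroup])
    fix P assume P: "P \<lhd> G_Br_image X"
    have subP': "subgroup P (?B\<lparr>carrier := ?\<pi> ` K\<rparr>)" using P normal_imp_subgroup eq by metis
    have subP: "subgroup P ?B" by (rule group.incl_subgroup[OF group_BijGroup sub subP'])
    have PK: "P \<subseteq> ?\<pi> ` K" using subgroup.subset[OF subP'] by simp
    have normP: "k \<otimes>\<^bsub>?B\<^esub> n \<otimes>\<^bsub>?B\<^esub> inv\<^bsub>?B\<^esub> k \<in> P" if "k \<in> ?\<pi> ` K" "n \<in> P" for k n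
      using normal.inv_op_closed2[of P "?B\<lparr>carrier := ?\<pi> ` K\<rparr>" k n] P that
        group.m_inv_consistent[OF group_BijGroup sub that(1)] by (simp add: eq)
    define N where "N = {k \<in> K. ?\<pi> k \<in> P}"
    have N: "subgroup N G"
    proof (rule G.subgroupI)
      show "N \<subseteq> carrier G" using KG by (auto simp: N_def)
      have "\<one>\<^bsub>G\<^esub> \<in> N"
        using subgroup.one_closed[OF subgroup_K] subgroup.one_closed[OF subP] \<pi>.hom_one by (simp add: N_def)
      then show "N \<noteq> {}" by blast
      show "inv\<^bsub>G\<^esub> n \<in> N" if "n \<in> N" for n
        using that KG subgroup.m_inv_closed[OF subgroup_K] subgroup.m_inv_closed[OF subP] by (simp add: N_def)
      show "m \<otimes>\<^bsub>G\<^esub> n \<in> N" if "m \<in> N" "n \<in> N" for m n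
        using that KG subgroup.m_closed[OF subgroup_K] subgroup.m_closed[OF subP] by (simp add: N_def)
    qed
    have NK: "N \<subseteq> K" by (auto simp: N_def)
    have norm: "k \<otimes>\<^bsub>G\<^esub> n \<otimes>\<^bsub>G\<^esub> inv\<^bsub>G\<^esub> k \<in> N" if kn: "k \<in> K" "n \<in> N" for k n
    proof -
      have "k \<otimes>\<^bsub>G\<^esub> n \<otimes>\<^bsub>G\<^esub> inv\<^bsub>G\<^esub> k \<in> K"
        using K_conj kn NK KG by blast
      moreover have "?\<pi> (k \<otimes>\<^bsub>G\<^esub> n \<otimes>\<^bsub>G\<^esub> inv\<^bsub>G\<^esub> k) \<in> P"
        using normP[of "?\<pi> k" "?\<pi> n"] kn KG by (auto simp: N_def)
      ultimately show ?thesis by (simp add: N_def)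
    qed
    have image: "?\<pi> ` N = P" using PK by (auto simp: N_def)
    show "P = {\<one>\<^bsub>G_Br_image X\<^esub>} \<or> P = carrier (G_Br_image X)"
    proof (cases "\<forall>n\<in>N. \<forall>q\<in>branch_points X. n q = q")
      case True
      have "?\<pi> n = \<one>\<^bsub>?B\<^esub>" if n: "n \<in> N" for n
      proof -
        have "n ` A = A" if "A \<in> Free X" for A
          using Free_invariant_if_fixes_branch_points[OF min _ _ that, of n] True n NK KG by blast
        then have "?\<pi> n = (\<lambda>A\<in>Free X. A)" unfolding free_perm_def by (intro restrict_ext)
        then show ?thesis by (simp add: BijGroup_def)
      qed
      then have "P = {\<one>\<^bsub>?B\<^esub>}" using image subgroup.one_closed[OF subP] by auto
      then show ?thesis by (simp add: eq)
    next
      case False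
      then obtain n q where "n \<in> N" "q \<in> branch_points X" "n q \<noteq> q" by blast
      then have "N = K" using normal_subgroup_moving_branch_point[OF min N NK norm] by blast
      then show ?thesis using image by (simp add: eq)
    qed
  qed
qed

end

theorem corollary1p4:
  fixes X :: "'a topology"
  assumes "dendrite X" and "dendro_minimal X" and "\<not> (\<exists>x. topspace X = {x})"
  shows "(\<not> (\<exists>A. free_arc X A) \<longrightarrow> is_simple (G_Br X)) \<and>
         ((\<exists>A. free_arc X A) \<and> \<not> X homeomorphic_space top_of_set {0..1::real}
            \<longrightarrow> is_simple (G_Br_image X))"
proof -
  interpret dendrite_space X by unfold_locales (rule assms(1))
  show ?thesis using simple_G_Br[OF assms(2)] simple_G_Br_image[OF assms(2)] by blast
qed

end
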